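(* Suppose that the discrete-time robust control contraction metric condition (RCCM) holds and that the proportional error bound (PEB) is valid, and let the terminal ingredients of the tube MPC problem $\mathcal P(\cdot)$ be $$k_f(\bar x)\equiv0_{n_u},\qquad \ell_f(\bar x,\delta)=\frac{\lambda}{\rho_c}\delta^2,$$ $$\mathcal X_f=\{(\bar x,\delta)\in\mathbb R^{n_x}\times\mathbb R_{\ge0}\mid\bar x=0_{n_x},\ h_j(\bar x,k_f(\bar x))+c_j\delta\le0\ \forall j\in\{1,\dots,n_h\}\}.$$ Let $\mathcal X_N$ be the set of initial states $x(0)$ for which $\mathcal P(x(0))$ is feasible. Then the closed-loop system $x(k+1)=F(x(k),u(k))$, $u(k)=\kappa(x(k),\bar x^*_{0|k},\bar u^*_{0|k})$, where $\{\bar x^*_{i|k},\bar u^*_{i|k},\delta^*_{i|k}\}$ is the solution returned at time $k$ by the online algorithm (ALG), is exponentially stable on $\mathcal X_N$.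
   Context: Exponentially stable on $\mathcal X_N$ means: there exist constants $C>0$ and $\sigma\in(0,1)$ such that $\|x(k)\|\le C\sigma^k\|x(0)\|$ for all $k\ge0$ and all $x(0)\in\mathcal X_N$. Notation: $\|\cdot\|$ is the Euclidean norm, $\|y\|_P=\sqrt{y^\top P y}$, $\mathcal B(y,r)$ is the closed ball, $\otimes$ the Kronecker product, $\preceq$ the Loewner order, $\mathbb S_+^n$ the symmetric positive definite $n\times n$ matrices, $\|\cdot\|_F$ the Frobenius norm; $P^{1/2}$ is the Cholesky factor with $P=(P^{1/2})^\top P^{1/2}$ and $P^{-1/2}$ its inverse. System. $\mathbb X\subset\mathbb R^{n_x}$ and $\mathbb U\subset\mathbb R^{n_u}$ are compact, and $\mathbb U$ contains the standard basis vectors $e_1,\dots,e_{n_u}$. The true system is $\dot x=f(x)+g(x)u$ with $f(0)=0$; $x(t;\hat x,u)$ is its solution at time $t$ from $\hat x$ under constant input $u$ (provided it exists), $T_s>0$ is fixed, and $F(x,u)=x(T_s;x,u)$ is the sampled true map. The constraint set $\mathcal Z=\{(x,u)\in\mathbb R^{n_x}\times\mathbb R^{n_u}\mid h_j(x,u)\le0,\ j=1,\dots,n_h\}\subseteq\mathbb X\times\mathbb U$ is compact, each $h_j$ is continuously differentiable and $h_j(0,0)<0$. Learned model. $\hat\Phi(x)=[x^\top\ \phi_{n_x+1}(x)\cdots\phi_{n_z}(x)]^\top\in\mathbb R^{n_z}$, $n_z>n_x$, with continuously differentiable $\phi_\ell:\mathbb R^{n_x}\to\mathbb R$, $\phi_\ell(0)=0$.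 From data $y_j^{\tilde u}=F(x_j^{\tilde u},\tilde u)$, $j=1,\dots,d$, $\tilde u\in\{0,e_1,\dots,e_{n_u}\}$, the matrices $A,B_i\in\mathbb R^{n_z\times n_z}$ and $b_i\in\mathbb R^{n_z}$ are least-squares fits: $A$ minimizes $\|[\hat\Phi(y_1^0)\cdots\hat\Phi(y_d^0)]-A[\hat\Phi(x_1^0)\cdots\hat\Phi(x_d^0)]\|_F$, and $[b_i\ B_i]$ minimizes $\|[\hat\Phi(y_1^{e_i})\cdots\hat\Phi(y_d^{e_i})]-[b_i\ B_i][\Phi(x_1^{e_i})\cdots\Phi(x_d^{e_i})]\|_F$ with $\Phi=[1\ \hat\Phi^\top]^\top$. Put $B_0=[b_1\cdots b_{n_u}]$, $\mathcal L(x,u)=A\hat\Phi(x)+B_0u+\sum_{i=1}^{n_u}(B_i-A)u_i\hat\Phi(x)$, $\xi(x,u)=\hat\Phi(F(x,u))-\mathcal L(x,u)$, and $\hat F(x,u)=[I_{n_x}\ 0_{n_x\times(n_z-n_x)}]\,\mathcal L(x,u)$. (PEB) with constants $c_x,c_u\ge0$: $\|\xi(x,u)\|\le c_x\|\hat\Phi(x)\|+c_u\|u\|$ for all $x\in\mathbb X$, $u\in\mathbb U$. Uncertain predictor. $E(x,u)=[c_x(\hat\Phi(x)^\top\otimes I_{n_x})\ \ c_u(u^\top\otimes I_{n_x})]$; $\mathbb D$ is the set of vectors $\begin{bmatrix}w_\Phi\otimes w_x\\ w_u\otimes w_x\end{bmatrix}$ with $w_\Phi\in\mathcal B(0_{n_z},1)$,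 $w_u\in\mathcal B(0_{n_u},1)$, $w_x\in\mathcal B(0_{n_x},1)$; and $f_w(x,u,w)=\hat F(x,u)+E(x,u)w$. (RCCM): $M:\mathbb R^{n_x}\to\mathbb S_+^{n_x}$ is continuously differentiable, $K:\mathbb R^{n_x}\to\mathbb R^{n_u\times n_x}$ is continuous, $0<\rho_c<1$, $\alpha_1,\alpha_2>0$, and for all $(x,u)\in\mathcal Z$, $w\in\mathbb D$, with $x_+=f_w(x,u,w)$ and $A_{cl}(x,u,w)=\frac{\partial f_w}{\partial x}(x,u,w)+\frac{\partial f_w}{\partial u}(x,u,w)K(x)$: $A_{cl}^\top M(x_+)A_{cl}\preceq(1-\rho_c)M(x)$, $\alpha_1I\preceq M(x)\preceq\alpha_2I$, and $M(x_+)\preceq\alpha_2I$. Distance and feedback. $\Gamma(\bar x,x)$ is the set of componentwise continuously differentiable curves $\gamma:[0,1]\to\mathbb R^{n_x}$ with $\gamma(0)=\bar x$, $\gamma(1)=x$. $V(x,\bar x)=\min_{\gamma\in\Gamma(\bar x,x)}\int_0^1\|\dot\gamma(s)\|_{M(\gamma(s))}ds$ is the Riemannian distance, $\gamma^*$ denotes a minimizer (geodesic, taken to exist). $\gamma^u(s)=\bar u+\int_0^sK(\gamma^*(s'))\dot\gamma^*(s')ds'$ and $\kappa(x,\bar x,\bar u)=\gamma^u(1)$. Tightening constants: $c_j=\max_{(x,u)\in\mathcal Z}\|(\frac{\partial h_j}{\partial x}(x,u)+\frac{\partial h_j}{\partial u}(x,u)K(x))M(x)^{-1/2}\|$. Stage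 cost: $\ell(\bar x,\bar u,\delta)=\|\bar x\|_Q^2+\|\bar u\|_R^2+\lambda\delta^2$, $Q\in\mathbb S_+^{n_x}$, $R\in\mathbb S_+^{n_u}$, $\lambda>0$. Tube MPC problem $\mathcal P(x(k))$ (horizon $N$): minimize $\sum_{i=0}^{N-1}\ell(\bar x_{i|k},\bar u_{i|k},\delta_{i|k})+\ell_f(\bar x_{N|k},\delta_{N|k})$ over $\bar x_{\cdot|k},\bar u_{\cdot|k},\delta_{\cdot|k}$ subject to, for $i=0,\dots,N-1$ and $j=1,\dots,n_h$: $\bar x_{i+1|k}=\hat F(\bar x_{i|k},\bar u_{i|k})$; $\delta_{i+1|k}=\sqrt{1-\rho_c}\,\delta_{i|k}+\sqrt{\alpha_2}(c_x\|\hat\Phi(\bar x_{i|k})\|+c_u\|\bar u_{i|k}\|)$; $h_j(\bar x_{i|k},\bar u_{i|k})+c_j\delta_{i|k}\le0$; $V(x(k),\bar x_{0|k})=\delta_{0|k}$; $(\bar x_{N|k},\delta_{N|k})\in\mathcal X_f$. (ALG) At each time $k$: the candidate is initialized as some feasible solution of $\mathcal P(x(0))$ if $k=0$, and as the shifted previous solution if $k\ge1$; a numerical solver is run on $\mathcal P(x(k))$ for a limited time, and if it finds a feasible solution with smaller cost the candidate is replaced by it (no optimality is required); then, if the local solution $\bar x_{i|k}=0$, $\bar u_{i|k}=0$, $\delta_{i|k}=(\sqrt{1-\rho_c})^iV(x(k),0)$, $i=0,\dots,N$, is feasible and has smaller cost, the candidate is replaced by it. The resulting candidate is the returned solution (denoted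 with $*$), and $u(k)=\kappa(x(k),\bar x^*_{0|k},\bar u^*_{0|k})$ is applied. The shifted previous solution at time $k+1$ is: $\bar x_{0|k+1}=\bar x^*_{1|k}$, $\delta_{0|k+1}=V(x(k+1),\bar x_{0|k+1})$, $\bar u_{i|k+1}=\bar u^*_{i+1|k}$ for $i=0,\dots,N-1$, where $\bar u^*_{N|k}:=k_f(\bar x^*_{N|k})$, with the remaining $\bar x_{i|k+1},\delta_{i|k+1}$ given by the two recursions of $\mathcal P$.
   Formalization: Adds the hypothesis that every point of Z is a limit of points (x,u) with h_j(x,u)<0 for all j with c_j=0; without it the claim fails, e.g. when Z has an isolated point on the boundary of a constraint with c_j=0. *)

theory Defs
  imports "HOL-Analysis.Analysis"
begin

section \<open>Linear algebra and differentiability\<close>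

definition pos_def :: "real^'n^'n \<Rightarrow> bool" where
  "pos_def P \<longleftrightarrow> transpose P = P \<and> (\<forall>v. v \<noteq> 0 \<longrightarrow> 0 < v \<bullet> (P *v v))"

definition pos_semidef :: "real^'n^'n \<Rightarrow> bool" where
  "pos_semidef P \<longleftrightarrow> transpose P = P \<and> (\<forall>v. 0 \<le> v \<bullet> (P *v v))"

definition loewner_le :: "real^'n^'n \<Rightarrow> real^'n^'n \<Rightarrow> bool" (infix \<open>\<preceq>\<^sub>L\<close> 50) where
  "P \<preceq>\<^sub>L P' \<longleftrightarrow> pos_semidef (P' - P)"

definition wnorm :: "real^'n^'n \<Rightarrow> real^'n \<Rightarrow> real" where
  "wnorm P y = sqrt (y \<bullet> (P *v y))"

text \<open>The upper triangular factor \<open>L\<close> with positive diagonal and \<open>P = L\<^sup>T L\<close>; for positive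
  definite \<open>P\<close> it exists and is unique. The order on the index type fixes what triangular means.\<close>

definition cholesky :: "((real, 'n::{finite,linorder}) vec, 'n) vec \<Rightarrow> ((real, 'n) vec, 'n) vec" where
  "cholesky P = (SOME L. (\<forall>i j. j < i \<longrightarrow> L $ i $ j = 0) \<and> (\<forall>i. 0 < L $ i $ i)
                         \<and> P = transpose L ** L)"

definition inv_sqrt :: "((real, 'n::{finite,linorder}) vec, 'n) vec \<Rightarrow> ((real, 'n) vec, 'n) vec" where
  "inv_sqrt P = matrix_inv (cholesky P)"

definition join_vec :: "real^'a \<Rightarrow> real^'b \<Rightarrow> real^('a + 'b)" where
  "join_vec v w = (\<chi> p. case p of Inl i \<Rightarrow> v $ i | Inr j \<Rightarrow> w $ j)"

definition join_cols :: "real^'a^'k \<Rightarrow> real^'b^'k \<Rightarrow> real^('a + 'b)^'k" where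
  "join_cols P P' = (\<chi> r. join_vec (P $ r) (P' $ r))"

definition cols :: "('d \<Rightarrow> real^'k) \<Rightarrow> real^'d^'k" where
  "cols v = (\<chi> r j. v j $ r)"

text \<open>Kronecker products \<open>v \<otimes> w\<close> of two column vectors and \<open>v\<^sup>T \<otimes> P\<close> of a row vector with a
  matrix; a pair of indices stands for the position in the Kronecker product.\<close>

definition kron_vec :: "real^'a \<Rightarrow> real^'b \<Rightarrow> real^('a \<times> 'b)" where
  "kron_vec v w = (\<chi> p. v $ fst p * w $ snd p)"

definition row_kron :: "real^'a \<Rightarrow> real^'b^'k \<Rightarrow> real^('a \<times> 'b)^'k" where
  "row_kron v P = (\<chi> r p. v $ fst p * P $ r $ snd p)"

definition continuously_differentiable ::
    "('a::real_normed_vector \<Rightarrow> 'b::real_normed_vector) \<Rightarrow> bool" where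
  "continuously_differentiable f \<longleftrightarrow>
     (\<exists>f'. (\<forall>x. (f has_derivative blinfun_apply (f' x)) (at x)) \<and> continuous_on UNIV f')"

definition gradient :: "(real^'n \<Rightarrow> real) \<Rightarrow> real^'n \<Rightarrow> real^'n" where
  "gradient q x = (\<chi> i. frechet_derivative q (at x) (axis i 1))"


section \<open>Data of the control problem\<close>

text \<open>The index types \<open>'nx\<close>, \<open>'nu\<close>, \<open>'d\<close>, \<open>'j\<close> have \<open>n\<^sub>x\<close>, \<open>n\<^sub>u\<close>, \<open>d\<close> and \<open>n\<^sub>h\<close> elements.
  Lifted vectors are indexed by \<open>'nx + 'ne\<close>, so \<open>n\<^sub>z = n\<^sub>x + CARD('ne) > n\<^sub>x\<close>, and
  \<open>'ne\<close> indexes the observables other than the coordinates of the state.\<close>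

record ('nx, 'ne, 'nu, 'd, 'j) setting =
  state_set :: "(real^'nx) set"
  input_set :: "(real^'nu) set"
  drift :: "real^'nx \<Rightarrow> real^'nx"
  input_map :: "real^'nx \<Rightarrow> real^'nu^'nx"
  samp_time :: real
  hcon :: "'j \<Rightarrow> real^'nx \<Rightarrow> real^'nu \<Rightarrow> real"
  obs :: "'ne \<Rightarrow> real^'nx \<Rightarrow> real"
  data_pt :: "real^'nu \<Rightarrow> 'd \<Rightarrow> real^'nx"
  matA :: "real^('nx + 'ne)^('nx + 'ne)"
  matB :: "'nu \<Rightarrow> real^('nx + 'ne)^('nx + 'ne)"
  vecb :: "'nu \<Rightarrow> real^('nx + 'ne)"
  err_x :: real
  err_u :: real
  metric :: "real^'nx \<Rightarrow> real^'nx^'nx"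
  gain :: "real^'nx \<Rightarrow> real^'nx^'nu"
  rho_c :: real
  alpha1 :: real
  alpha2 :: real
  geodesic :: "real^'nx \<Rightarrow> real^'nx \<Rightarrow> real \<Rightarrow> real^'nx"
  weightQ :: "real^'nx^'nx"
  weightR :: "real^'nu^'nu"
  weightD :: real
  horizon :: nat
  term_ctrl :: "real^'nx \<Rightarrow> real^'nu"
  term_cost :: "real^'nx \<Rightarrow> real \<Rightarrow> real"
  term_set :: "((real^'nx) \<times> real) set"


section \<open>True system and constraints\<close>

definition ode_solution ::
    "('nx::finite, 'ne::finite, 'nu::finite, 'd::finite, 'j::finite) setting
      \<Rightarrow> real^'nx \<Rightarrow> real^'nu \<Rightarrow> (real \<Rightarrow> real^'nx) \<Rightarrow> bool" where
  "ode_solution S x u y \<longleftrightarrow> y 0 = x \<and>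
     (\<forall>t\<in>{0..samp_time S}. (y has_vector_derivative (drift S (y t) + input_map S (y t) *v u))
                            (at t within {0..samp_time S}))"

definition sampled_value ::
    "('nx::finite, 'ne::finite, 'nu::finite, 'd::finite, 'j::finite) setting
      \<Rightarrow> real^'nx \<Rightarrow> real^'nu \<Rightarrow> real^'nx \<Rightarrow> bool" where
  "sampled_value S x u p \<longleftrightarrow> (\<exists>y. ode_solution S x u y \<and> y (samp_time S) = p)"

definition F_defined ::
    "('nx::finite, 'ne::finite, 'nu::finite, 'd::finite, 'j::finite) setting
      \<Rightarrow> real^'nx \<Rightarrow> real^'nu \<Rightarrow> bool" where
  "F_defined S x u \<longleftrightarrow> (\<exists>!p. sampled_value S x u p)"

definition Fmap ::
    "('nx::finite, 'ne::finite, 'nu::finite, 'd::finite, 'j::finite) setting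
      \<Rightarrow> real^'nx \<Rightarrow> real^'nu \<Rightarrow> real^'nx" where
  "Fmap S x u = (THE p. sampled_value S x u p)"

definition Zset ::
    "('nx::finite, 'ne::finite, 'nu::finite, 'd::finite, 'j::finite) setting
      \<Rightarrow> ((real^'nx) \<times> (real^'nu)) set" where
  "Zset S = {(x, u). \<forall>j. hcon S j x u \<le> 0}"

definition system_assms ::
    "('nx::finite, 'ne::finite, 'nu::finite, 'd::finite, 'j::finite) setting \<Rightarrow> bool" where
  "system_assms S \<longleftrightarrow>
     compact (state_set S) \<and> compact (input_set S) \<and> (\<forall>i. axis i 1 \<in> input_set S) \<and>
     drift S 0 = 0 \<and> 0 < samp_time S \<and>
     compact (Zset S) \<and> Zset S \<subseteq> state_set S \<times> input_set S \<and>
     (\<forall>j. continuously_differentiable (\<lambda>(x, u). hcon S j x u) \<and> hcon S j 0 0 < 0)"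


section \<open>Learned model\<close>

definition lift ::
    "('nx::finite, 'ne::finite, 'nu::finite, 'd::finite, 'j::finite) setting
      \<Rightarrow> real^'nx \<Rightarrow> real^('nx + 'ne)" where
  "lift S x = join_vec x (\<chi> l. obs S l x)"

definition lift1 ::
    "('nx::finite, 'ne::finite, 'nu::finite, 'd::finite, 'j::finite) setting
      \<Rightarrow> real^'nx \<Rightarrow> real^(1 + ('nx + 'ne))" where
  "lift1 S x = join_vec (vec 1) (lift S x)"

definition model ::
    "('nx::finite, 'ne::finite, 'nu::finite, 'd::finite, 'j::finite) setting
      \<Rightarrow> real^'nx \<Rightarrow> real^'nu \<Rightarrow> real^('nx + 'ne)" where
  "model S x u = matA S *v lift S x + cols (vecb S) *v u
     + (\<Sum>i\<in>UNIV. (matB S i - matA S) *v (u $ i *\<^sub>R lift S x))"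

definition Fhat ::
    "('nx::finite, 'ne::finite, 'nu::finite, 'd::finite, 'j::finite) setting
      \<Rightarrow> real^'nx \<Rightarrow> real^'nu \<Rightarrow> real^'nx" where
  "Fhat S x u = (\<chi> i. model S x u $ Inl i)"

text \<open>The norm of the iterated vector type \<open>real^'d^'k\<close> is the Frobenius norm.\<close>

definition least_squares_fit :: "real^'d^'k \<Rightarrow> real^'m^'k \<Rightarrow> real^'d^'m \<Rightarrow> bool" where
  "least_squares_fit Y G W \<longleftrightarrow> (\<forall>G'. norm (Y - G ** W) \<le> norm (Y - G' ** W))"

definition learned_assms ::
    "('nx::finite, 'ne::finite, 'nu::finite, 'd::finite, 'j::finite) setting \<Rightarrow> bool" where
  "learned_assms S \<longleftrightarrow>
     (\<forall>l. continuously_differentiable (obs S l) \<and> obs S l 0 = 0) \<and>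
     (\<forall>u\<in>insert 0 (range (\<lambda>i. axis i 1)). \<forall>k. F_defined S (data_pt S u k) u) \<and>
     least_squares_fit (cols (\<lambda>k. lift S (Fmap S (data_pt S 0 k) 0))) (matA S)
       (cols (\<lambda>k. lift S (data_pt S 0 k))) \<and>
     (\<forall>i. least_squares_fit
        (cols (\<lambda>k. lift S (Fmap S (data_pt S (axis i 1) k) (axis i 1))))
        (join_cols (columnvector (vecb S i) :: real^1^('nx + 'ne)) (matB S i))
        (cols (\<lambda>k. lift1 S (data_pt S (axis i 1) k))))"

text \<open>\<^const>\<open>F_defined\<close> occurs because the error bound speaks about \<open>F(x,u)\<close>, which is only
  meaningful where the solution of the differential equation exists up to the sampling time.\<close>

definition peb ::
    "('nx::finite, 'ne::finite, 'nu::finite, 'd::finite, 'j::finite) setting \<Rightarrow> bool" where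
  "peb S \<longleftrightarrow> 0 \<le> err_x S \<and> 0 \<le> err_u S \<and>
     (\<forall>x\<in>state_set S. \<forall>u\<in>input_set S. F_defined S x u \<and>
        norm (lift S (Fmap S x u) - model S x u) \<le> err_x S * norm (lift S x) + err_u S * norm u)"

definition Emat ::
    "('nx::finite, 'ne::finite, 'nu::finite, 'd::finite, 'j::finite) setting
      \<Rightarrow> real^'nx \<Rightarrow> real^'nu \<Rightarrow> real^(('nx + 'ne) \<times> 'nx + 'nu \<times> 'nx)^'nx" where
  "Emat S x u = join_cols (err_x S *\<^sub>R row_kron (lift S x) (mat 1))
                          (err_u S *\<^sub>R row_kron u (mat 1))"

definition Dset :: "(real^('z::finite \<times> 'x::finite + 'u::finite \<times> 'x)) set" where
  "Dset = {join_vec (kron_vec w\<^sub>z w\<^sub>x) (kron_vec w\<^sub>u w\<^sub>x) | w\<^sub>z w\<^sub>u w\<^sub>x.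
             w\<^sub>z \<in> cball 0 1 \<and> w\<^sub>u \<in> cball 0 1 \<and> w\<^sub>x \<in> cball 0 1}"

definition fw ::
    "('nx::finite, 'ne::finite, 'nu::finite, 'd::finite, 'j::finite) setting
      \<Rightarrow> real^'nx \<Rightarrow> real^'nu \<Rightarrow> real^(('nx + 'ne) \<times> 'nx + 'nu \<times> 'nx) \<Rightarrow> real^'nx" where
  "fw S x u w = Fhat S x u + Emat S x u *v w"


section \<open>Contraction metric, Riemannian distance and feedback\<close>

definition Acl ::
    "('nx::finite, 'ne::finite, 'nu::finite, 'd::finite, 'j::finite) setting
      \<Rightarrow> real^'nx \<Rightarrow> real^'nu \<Rightarrow> real^(('nx + 'ne) \<times> 'nx + 'nu \<times> 'nx) \<Rightarrow> real^'nx^'nx" where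
  "Acl S x u w = jacobian (\<lambda>x'. fw S x' u w) (at x) + jacobian (\<lambda>u'. fw S x u' w) (at u) ** gain S x"

definition rccm ::
    "('nx::finite, 'ne::finite, 'nu::finite, 'd::finite, 'j::finite) setting \<Rightarrow> bool" where
  "rccm S \<longleftrightarrow>
     (\<forall>x. pos_def (metric S x)) \<and> continuously_differentiable (metric S) \<and>
     continuous_on UNIV (gain S) \<and>
     0 < rho_c S \<and> rho_c S < 1 \<and> 0 < alpha1 S \<and> 0 < alpha2 S \<and>
     (\<forall>(x, u)\<in>Zset S. \<forall>w\<in>Dset.
        transpose (Acl S x u w) ** metric S (fw S x u w) ** Acl S x u w
            \<preceq>\<^sub>L (1 - rho_c S) *\<^sub>R metric S x \<and>
        alpha1 S *\<^sub>R mat 1 \<preceq>\<^sub>L metric S x \<and> metric S x \<preceq>\<^sub>L alpha2 S *\<^sub>R mat 1 \<and>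
        metric S (fw S x u w) \<preceq>\<^sub>L alpha2 S *\<^sub>R mat 1)"

text \<open>Curves live on \<open>[0,1]\<close>: derivatives at the end points are one-sided, and values outside the
  unit interval are irrelevant.\<close>

definition C1_curves :: "real^'n \<Rightarrow> real^'n \<Rightarrow> (real \<Rightarrow> real^'n) set" where
  "C1_curves a b = {\<gamma>. \<gamma> 0 = a \<and> \<gamma> 1 = b \<and>
     (\<exists>\<gamma>'. (\<forall>s\<in>{0..1}. (\<gamma> has_vector_derivative \<gamma>' s) (at s within {0..1})) \<and>
           continuous_on {0..1} \<gamma>')}"

definition velocity :: "(real \<Rightarrow> real^'n) \<Rightarrow> real \<Rightarrow> real^'n" where
  "velocity \<gamma> s = vector_derivative \<gamma> (at s within {0..1})"

definition curve_length :: "(real^'n \<Rightarrow> real^'n^'n) \<Rightarrow> (real \<Rightarrow> real^'n) \<Rightarrow> real" where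
  "curve_length M \<gamma> = integral {0..1} (\<lambda>s. wnorm (M (\<gamma> s)) (velocity \<gamma> s))"

text \<open>The minimum defining the distance is written as an infimum; it is attained by virtue of
  \<open>geodesic_selection\<close> below.\<close>

definition Vdist ::
    "('nx::finite, 'ne::finite, 'nu::finite, 'd::finite, 'j::finite) setting
      \<Rightarrow> real^'nx \<Rightarrow> real^'nx \<Rightarrow> real" where
  "Vdist S x xb = (INF \<gamma>\<in>C1_curves xb x. curve_length (metric S) \<gamma>)"

definition geodesic_selection ::
    "('nx::finite, 'ne::finite, 'nu::finite, 'd::finite, 'j::finite) setting \<Rightarrow> bool" where
  "geodesic_selection S \<longleftrightarrow>
     (\<forall>xb x. geodesic S xb x \<in> C1_curves xb x \<and>
        (\<forall>\<gamma>\<in>C1_curves xb x. curve_length (metric S) (geodesic S xb x) \<le> curve_length (metric S) \<gamma>))"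

definition input_curve ::
    "('nx::finite, 'ne::finite, 'nu::finite, 'd::finite, 'j::finite) setting
      \<Rightarrow> real^'nx \<Rightarrow> real^'nx \<Rightarrow> real^'nu \<Rightarrow> real \<Rightarrow> real^'nu" where
  "input_curve S x xb ub s =
     ub + integral {0..s} (\<lambda>s'. gain S (geodesic S xb x s') *v velocity (geodesic S xb x) s')"

definition kappa ::
    "('nx::finite, 'ne::finite, 'nu::finite, 'd::finite, 'j::finite) setting
      \<Rightarrow> real^'nx \<Rightarrow> real^'nx \<Rightarrow> real^'nu \<Rightarrow> real^'nu" where
  "kappa S x xb ub = input_curve S x xb ub 1"

text \<open>The maximum over the compact nonempty constraint set, written as a supremum.\<close>

definition tightening ::
    "('nx::{finite,linorder}, 'ne::finite, 'nu::finite, 'd::finite, 'j::finite) setting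
      \<Rightarrow> 'j \<Rightarrow> real" where
  "tightening S j = (SUP (x, u)\<in>Zset S.
     norm ((gradient (\<lambda>x'. hcon S j x' u) x + gradient (\<lambda>u'. hcon S j x u') u v* gain S x)
             v* inv_sqrt (metric S x)))"

text \<open>Regularity of the constraint set, required only for constraints that are not tightened:
  every point of the constraint set is a limit of points at which those constraints are strict.
  Without it an isolated point on the boundary of an untightened constraint can be a feasible
  nominal state although its tube is not contained in the constraint set.\<close>

definition untightened_regular ::
    "('nx::{finite,linorder}, 'ne::finite, 'nu::finite, 'd::finite, 'j::finite) setting \<Rightarrow> bool" where
  "untightened_regular S \<longleftrightarrow>
     Zset S \<subseteq> closure {(x, u). \<forall>j. tightening S j = 0 \<longrightarrow> hcon S j x u < 0}"


section \<open>Tube MPC\<close>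

text \<open>Only \<open>xbar\<close> and \<open>delta\<close> at \<open>0, \<dots>, N\<close> and \<open>ubar\<close> at \<open>0, \<dots>, N - 1\<close> are meaningful.\<close>

record ('nx, 'nu) plan =
  xbar :: "nat \<Rightarrow> real^'nx"
  ubar :: "nat \<Rightarrow> real^'nu"
  delta :: "nat \<Rightarrow> real"

definition mpc_assms ::
    "('nx::{finite,linorder}, 'ne::finite, 'nu::finite, 'd::finite, 'j::finite) setting \<Rightarrow> bool" where
  "mpc_assms S \<longleftrightarrow> pos_def (weightQ S) \<and> pos_def (weightR S) \<and> 0 < weightD S \<and> 1 \<le> horizon S"

definition stage_cost ::
    "('nx::{finite,linorder}, 'ne::finite, 'nu::finite, 'd::finite, 'j::finite) setting
      \<Rightarrow> (real, 'nx) vec \<Rightarrow> real^'nu \<Rightarrow> real \<Rightarrow> real" where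
  "stage_cost S x u \<delta> = (wnorm (weightQ S) x)\<^sup>2 + (wnorm (weightR S) u)\<^sup>2 + weightD S * \<delta>\<^sup>2"

definition plan_cost ::
    "('nx::{finite,linorder}, 'ne::finite, 'nu::finite, 'd::finite, 'j::finite) setting
      \<Rightarrow> ('nx, 'nu) plan \<Rightarrow> real" where
  "plan_cost S p = (\<Sum>i<horizon S. stage_cost S (xbar p i) (ubar p i) (delta p i))
     + term_cost S (xbar p (horizon S)) (delta p (horizon S))"

definition delta_next ::
    "('nx::{finite,linorder}, 'ne::finite, 'nu::finite, 'd::finite, 'j::finite) setting
      \<Rightarrow> (real, 'nx) vec \<Rightarrow> real^'nu \<Rightarrow> real \<Rightarrow> real" where
  "delta_next S x u \<delta> = sqrt (1 - rho_c S) * \<delta>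
     + sqrt (alpha2 S) * (err_x S * norm (lift S x) + err_u S * norm u)"

definition feasible ::
    "('nx::{finite,linorder}, 'ne::finite, 'nu::finite, 'd::finite, 'j::finite) setting
      \<Rightarrow> (real, 'nx) vec \<Rightarrow> ('nx, 'nu) plan \<Rightarrow> bool" where
  "feasible S x p \<longleftrightarrow>
     (\<forall>i<horizon S.
        xbar p (Suc i) = Fhat S (xbar p i) (ubar p i) \<and>
        delta p (Suc i) = delta_next S (xbar p i) (ubar p i) (delta p i) \<and>
        (\<forall>j. hcon S j (xbar p i) (ubar p i) + tightening S j * delta p i \<le> 0)) \<and>
     Vdist S x (xbar p 0) = delta p 0 \<and>
     (xbar p (horizon S), delta p (horizon S)) \<in> term_set S"

definition feasible_states ::
    "('nx::{finite,linorder}, 'ne::finite, 'nu::finite, 'd::finite, 'j::finite) setting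
      \<Rightarrow> (real, 'nx) vec set" where
  "feasible_states S = {x. \<exists>p. feasible S x p}"

primrec rollout ::
    "('nx::{finite,linorder}, 'ne::finite, 'nu::finite, 'd::finite, 'j::finite) setting
      \<Rightarrow> (real, 'nx) vec \<Rightarrow> real \<Rightarrow> (nat \<Rightarrow> real^'nu) \<Rightarrow> nat \<Rightarrow> (real, 'nx) vec \<times> real" where
  "rollout S x \<delta> v 0 = (x, \<delta>)"
| "rollout S x \<delta> v (Suc i) =
     (let (x', \<delta>') = rollout S x \<delta> v i in (Fhat S x' (v i), delta_next S x' (v i) \<delta>'))"

text \<open>The shift of the plan \<open>p\<close> returned at the previous time, where \<open>x\<close> is the new measured state.\<close>

definition shifted_plan ::
    "('nx::{finite,linorder}, 'ne::finite, 'nu::finite, 'd::finite, 'j::finite) setting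
      \<Rightarrow> (real, 'nx) vec \<Rightarrow> ('nx, 'nu) plan \<Rightarrow> ('nx, 'nu) plan" where
  "shifted_plan S x p =
     (let v = (\<lambda>i. if Suc i < horizon S then ubar p (Suc i) else term_ctrl S (xbar p (horizon S)));
          r = rollout S (xbar p 1) (Vdist S x (xbar p 1)) v
      in \<lparr>xbar = (\<lambda>i. fst (r i)), ubar = v, delta = (\<lambda>i. snd (r i))\<rparr>)"

definition local_plan ::
    "('nx::{finite,linorder}, 'ne::finite, 'nu::finite, 'd::finite, 'j::finite) setting
      \<Rightarrow> (real, 'nx) vec \<Rightarrow> ('nx, 'nu) plan" where
  "local_plan S x =
     \<lparr>xbar = (\<lambda>i. 0), ubar = (\<lambda>i. 0), delta = (\<lambda>i. sqrt (1 - rho_c S) ^ i * Vdist S x 0)\<rparr>"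

text \<open>\<open>alg_returns S x c p\<close>: in state \<open>x\<close>, with initial candidate \<open>c\<close>, the online algorithm may return
  \<open>p\<close>. Here \<open>q\<close> is the candidate after the run of the (arbitrary) numerical solver.\<close>

definition alg_returns ::
    "('nx::{finite,linorder}, 'ne::finite, 'nu::finite, 'd::finite, 'j::finite) setting
      \<Rightarrow> (real, 'nx) vec \<Rightarrow> ('nx, 'nu) plan \<Rightarrow> ('nx, 'nu) plan \<Rightarrow> bool" where
  "alg_returns S x c p \<longleftrightarrow>
     (\<exists>q. (q = c \<or> feasible S x q \<and> plan_cost S q < plan_cost S c) \<and>
          p = (if feasible S x (local_plan S x) \<and> plan_cost S (local_plan S x) < plan_cost S q
               then local_plan S x else q))"

definition closed_loop ::
    "('nx::{finite,linorder}, 'ne::finite, 'nu::finite, 'd::finite, 'j::finite) setting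
      \<Rightarrow> (nat \<Rightarrow> (real, 'nx) vec) \<Rightarrow> bool" where
  "closed_loop S x \<longleftrightarrow>
     (\<exists>c p. feasible S (x 0) (c 0) \<and>
        (\<forall>k. c (Suc k) = shifted_plan S (x (Suc k)) (p k)) \<and>
        (\<forall>k. alg_returns S (x k) (c k) (p k)) \<and>
        (\<forall>k. x (Suc k) = Fmap S (x k) (kappa S (x k) (xbar (p k) 0) (ubar (p k) 0))))"

text \<open>The constants are uniform over all trajectories, hence over all initializations and all
  outcomes of the numerical solver.\<close>

definition exponentially_stable_on ::
    "('a::real_normed_vector) set \<Rightarrow> ((nat \<Rightarrow> 'a) \<Rightarrow> bool) \<Rightarrow> bool" where
  "exponentially_stable_on X traj \<longleftrightarrow>
     (\<exists>C \<sigma>. 0 < C \<and> 0 < \<sigma> \<and> \<sigma> < 1 \<and>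
        (\<forall>x. traj x \<and> x 0 \<in> X \<longrightarrow> (\<forall>k. norm (x k) \<le> C * \<sigma> ^ k * norm (x 0))))"

end

(* The cost of the returned plan is a Lyapunov function. The geodesic from the nominal state to the
   true state, together with the interpolated inputs, lies in the constraint set, because the
   tightening constants bound the growth of the constraint functions along it by its Riemannian length.
   On the constraint set the proportional error bound makes the successor state a value of the
   uncertain predictor for some disturbance w. The image of the geodesic under the predictor with this
   w is shorter by the factor sqrt (1 - rho_c), and the effect of w at the nominal point is covered by
   the second term of the recursion for delta. Hence the shifted plan is feasible and cheaper by the
   first stage cost. This stage cost dominates a multiple of |x|^2; conversely the cost is at most a
   multiple of |x|^2, near the origin thanks to the local plan and elsewhere by compactness. *)
theory Submission
  imports Defs
begin

section \<open>Square root factors and weighted norms\<close>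

text \<open>The tube claim looks circular: the tightening constants bound the growth of the
  constraint functions only at points of the constraint set, and staying there is the claim. A first
  exit argument breaks the circle but needs strict inequalities, while the tightened constraints are
  not strict. For a positive tightening constant, stopping short of the full length of the curve
  gives strictness. For a constant equal to zero it gives nothing, and there
  \<open>untightened_regular\<close> supplies nearby starting points. A limit then returns to the
  given curve, and whatever follows after the full length has been reached is stationary. The second
  obstacle is that the solver is arbitrary, so no optimal value function is at hand. A quadratic
  upper bound on the cost near the origin can only come from the explicit comparison with the local
  plan; boundedness alone says nothing there. The terminal weight \<lambda> / \<rho> is the sum of
  \<lambda> (1 - \<rho>)^i over all i, which is why a zero input appended at the origin is paid for
  exactly by the terminal cost.\<close>

lemma pos_def_inner_commute:
  fixes P :: "real^'n^'n"
  assumes "pos_def P"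
  shows "v \<bullet> (P *v w) = w \<bullet> (P *v v)"
proof -
  have "v \<bullet> (P *v w) = (v v* P) \<bullet> w"
    by (simp add: dot_lmul_matrix)
  also have "v v* P = P *v v"
    using assms unfolding pos_def_def by (metis transpose_matrix_vector)
  finally show ?thesis by (simp add: inner_commute)
qed

lemma wnorm_nonneg: "pos_def P \<Longrightarrow> 0 \<le> wnorm P y"
  unfolding wnorm_def pos_def_def
  by (metis inner_zero_left less_eq_real_def real_sqrt_ge_zero)

lemma wnorm_sq: "pos_def P \<Longrightarrow> (wnorm P y)\<^sup>2 = y \<bullet> (P *v y)"
  unfolding wnorm_def pos_def_def
  by (metis inner_zero_left less_eq_real_def real_sqrt_pow2)

lemma wnorm_eq_0: "pos_def P \<Longrightarrow> wnorm P y = 0 \<longleftrightarrow> y = 0"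
  unfolding wnorm_def pos_def_def
  by (metis inner_zero_left less_irrefl real_sqrt_eq_zero_cancel_iff)

lemma wnorm_scaleR: "wnorm P (c *\<^sub>R y) = \<bar>c\<bar> * wnorm P y"
  by (simp add: wnorm_def matrix_vector_mult_scaleR real_sqrt_mult mult.assoc[symmetric] flip: power2_eq_square)

lemma loewner_leD: "P \<preceq>\<^sub>L P' \<Longrightarrow> y \<bullet> (P *v y) \<le> y \<bullet> (P' *v y)"
  by (simp add: loewner_le_def pos_semidef_def matrix_vector_mult_diff_rdistrib inner_diff_right)

lemma wnorm_le_sqrt:
  assumes "y \<bullet> (P *v y) \<le> a * (norm y)\<^sup>2"
  shows "wnorm P y \<le> sqrt a * norm y"
  using assms unfolding wnorm_def
  by (metis norm_ge_zero real_sqrt_le_mono real_sqrt_mult real_sqrt_abs abs_of_nonneg)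

lemma wnorm_le_upper:
  assumes "P \<preceq>\<^sub>L a *\<^sub>R mat 1"
  shows "wnorm P y \<le> sqrt a * norm y"
proof -
  have "y \<bullet> (P *v y) \<le> a * (norm y)\<^sup>2"
    using loewner_leD[OF assms, of y] by (simp add: scaleR_matrix_vector_assoc[symmetric] power2_norm_eq_inner)
  then show ?thesis by (rule wnorm_le_sqrt)
qed

lemma wnorm_ge_lower:
  assumes "a *\<^sub>R mat 1 \<preceq>\<^sub>L P"
  shows "sqrt a * norm y \<le> wnorm P y"
proof -
  have "a * (norm y)\<^sup>2 \<le> y \<bullet> (P *v y)"
    using loewner_leD[OF assms, of y] by (simp add: scaleR_matrix_vector_assoc[symmetric] power2_norm_eq_inner)
  then show ?thesis
    unfolding wnorm_def by (metis norm_ge_zero real_sqrt_le_mono real_sqrt_mult real_sqrt_abs abs_of_nonneg)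
qed

text \<open>Gram-Schmidt for the inner product \<open>P\<close>, applied to the standard basis in increasing order:
  the coordinates of the basis vectors in the orthonormalized family form the Cholesky factor.\<close>

lemma gram_schmidt:
  fixes P :: "((real, 'n::{finite,linorder}) vec, 'n) vec"
  assumes "pos_def P" "finite A"
  shows "\<exists>r::'n \<Rightarrow> (real, 'n) vec.
    (\<forall>i\<in>A. \<forall>j\<in>A. r i \<bullet> (P *v r j) = (if i = j then 1 else 0)) \<and>
    (\<forall>j\<in>A. axis j 1 = (\<Sum>k\<in>A. (r k \<bullet> (P *v axis j 1)) *\<^sub>R r k)) \<and>
    (\<forall>j\<in>A. 0 < r j \<bullet> (P *v axis j 1)) \<and>
    (\<forall>k\<in>A. \<forall>j\<in>A. j < k \<longrightarrow> r k \<bullet> (P *v axis j 1) = 0) \<and>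
    (\<forall>k\<in>A. \<forall>i. i \<notin> A \<longrightarrow> r k $ i = 0)"
  using assms(2)
proof (induction A rule: finite_linorder_max_induct)
  case empty
  then show ?case by simp
next
  case (insert b A)
  note com = pos_def_inner_commute[OF assms(1)]
  have b: "b \<notin> A" using insert.hyps by blast
  obtain r :: "'n \<Rightarrow> (real, 'n) vec" where
    on: "\<And>i j. i \<in> A \<Longrightarrow> j \<in> A \<Longrightarrow> r i \<bullet> (P *v r j) = (if i = j then 1 else 0)" and
    ex: "\<And>j. j \<in> A \<Longrightarrow> axis j 1 = (\<Sum>k\<in>A. (r k \<bullet> (P *v axis j 1)) *\<^sub>R r k)" and
    pd: "\<And>j. j \<in> A \<Longrightarrow> 0 < r j \<bullet> (P *v axis j 1)" and
    tr: "\<And>k j. k \<in> A \<Longrightarrow> j \<in> A \<Longrightarrow> j < k \<Longrightarrow> r k \<bullet> (P *v axis j 1) = 0" and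
    su: "\<And>k i. k \<in> A \<Longrightarrow> i \<notin> A \<Longrightarrow> r k $ i = 0"
    using insert.IH by blast
  define z where "z = axis b 1 - (\<Sum>k\<in>A. (r k \<bullet> (P *v axis b 1)) *\<^sub>R r k)"
  \<comment> \<open>The earlier vectors are supported on \<open>A\<close>, so the subtraction cannot
    touch coordinate \<open>b\<close>. This is the purpose of the support clause in the induction:
    it replaces an argument about linear independence.\<close>
  have "z $ b = 1" using su[OF _ b] by (simp add: z_def)
  then have z0: "z \<noteq> 0" by auto
  define t where "t = sqrt (z \<bullet> (P *v z))"
  have zz: "0 < z \<bullet> (P *v z)" using assms(1) z0 by (auto simp: pos_def_def)
  then have t: "0 < t" "t * t = z \<bullet> (P *v z)" by (auto simp: t_def)
  have zr: "r i \<bullet> (P *v z) = 0" if "i \<in> A" for i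
  proof -
    have "r i \<bullet> (P *v (\<Sum>k\<in>A. (r k \<bullet> (P *v axis b 1)) *\<^sub>R r k))
        = (\<Sum>k\<in>A. (r k \<bullet> (P *v axis b 1)) * (r i \<bullet> (P *v r k)))"
      by (simp add: linear_sum[OF matrix_vector_mul_linear] matrix_vector_mult_scaleR inner_sum_right)
    also have "\<dots> = (\<Sum>k\<in>A. if i = k then r k \<bullet> (P *v axis b 1) else 0)"
      by (rule sum.cong) (auto simp: on[OF that])
    finally show ?thesis
      using that insert.hyps(1) by (simp add: z_def matrix_vector_mult_diff_distrib inner_diff_right)
  qed
  have zb: "z \<bullet> (P *v axis b 1) = z \<bullet> (P *v z)"
  proof -
    define c where "c = (\<lambda>k. r k \<bullet> (P *v axis b 1))"
    have "axis b 1 = z + (\<Sum>k\<in>A. c k *\<^sub>R r k)" by (simp add: z_def c_def)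
    then have "z \<bullet> (P *v axis b 1) = z \<bullet> (P *v z) + (\<Sum>k\<in>A. c k * (z \<bullet> (P *v r k)))"
      by (simp add: matrix_vector_right_distrib inner_add_right linear_sum[OF matrix_vector_mul_linear]
          matrix_vector_mult_scaleR inner_sum_right)
    also have "(\<Sum>k\<in>A. c k * (z \<bullet> (P *v r k))) = 0"
      by (rule sum.neutral) (metis com zr mult_zero_right)
    finally show ?thesis by simp
  qed
  \<comment> \<open>The basis vectors already treated lie in the span of the \<open>r k\<close>, to
    which \<open>z\<close> is orthogonal. This gives the zeros below the diagonal.\<close>
  have za: "z \<bullet> (P *v axis j 1) = 0" if "j \<in> A" for j
  proof -
    have "z \<bullet> (P *v axis j 1) = (\<Sum>k\<in>A. (r k \<bullet> (P *v axis j 1)) * (z \<bullet> (P *v r k)))"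
      by (subst ex[OF that])
        (simp add: linear_sum[OF matrix_vector_mul_linear] matrix_vector_mult_scaleR inner_sum_right)
    also have "\<dots> = 0"
      by (rule sum.neutral) (metis com zr mult_zero_right)
    finally show ?thesis .
  qed
  define r' where "r' = r(b := (1/t) *\<^sub>R z)"
  have r'A: "k \<in> A \<Longrightarrow> r' k = r k" for k using b by (auto simp: r'_def)
  have r'b: "r' b = (1/t) *\<^sub>R z" by (simp add: r'_def)
  have bb: "r' b \<bullet> (P *v axis b 1) = t"
    using t by (simp add: r'b zb field_simps)
  have sumA: "(\<Sum>k\<in>A. (r' k \<bullet> (P *v axis j 1)) *\<^sub>R r' k) = (\<Sum>k\<in>A. (r k \<bullet> (P *v axis j 1)) *\<^sub>R r k)" for j
    by (rule sum.cong) (auto simp: r'A)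
  show ?case
  proof (intro exI[of _ r'] conjI ballI allI impI)
    fix i j assume "i \<in> insert b A" "j \<in> insert b A"
    moreover have "r' b \<bullet> (P *v r' b) = 1"
      using t zz by (simp add: r'b matrix_vector_mult_scaleR field_simps)
    moreover have "r' b \<bullet> (P *v r' i) = 0" "r' i \<bullet> (P *v r' b) = 0" if "i \<in> A" for i
      using zr[OF that] com[of z "r i"] by (auto simp: r'b r'A[OF that] matrix_vector_mult_scaleR)
    ultimately show "r' i \<bullet> (P *v r' j) = (if i = j then 1 else 0)"
      using on[of i j] r'A b by auto
  next
    fix j assume j: "j \<in> insert b A"
    show "axis j 1 = (\<Sum>k\<in>insert b A. (r' k \<bullet> (P *v axis j 1)) *\<^sub>R r' k)"
    proof (cases "j = b")
      case True
      have "t *\<^sub>R r' b = z" using t by (simp add: r'b)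
      then show ?thesis
        using insert.hyps(1) b by (simp add: True sumA bb) (simp add: z_def)
    next
      case False
      with j have "j \<in> A" by simp
      then show ?thesis
        using insert.hyps(1) b ex[OF \<open>j \<in> A\<close>] by (simp add: sumA r'b za)
    qed
  next
    fix j assume "j \<in> insert b A"
    then show "0 < r' j \<bullet> (P *v axis j 1)" using bb t pd r'A by auto
  next
    fix k j assume "k \<in> insert b A" "j \<in> insert b A" "j < k"
    moreover have "r' b \<bullet> (P *v axis j 1) = 0" if "j \<in> A" using za[OF that] by (simp add: r'b)
    ultimately show "r' k \<bullet> (P *v axis j 1) = 0"
      using tr[of k j] r'A insert.hyps(2) by (metis insertE not_less_iff_gr_or_eq)
  next
    fix k i assume "k \<in> insert b A" "i \<notin> insert b A"
    moreover have "r' b $ i = 0" if "i \<noteq> b" "i \<notin> A"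
      using that su[of _ i] by (simp add: r'b z_def axis_def)
    ultimately show "r' k $ i = 0" using su r'A by auto
  qed
qed

lemma cholesky_exists:
  fixes P :: "((real, 'n::{finite,linorder}) vec, 'n) vec"
  assumes "pos_def P"
  shows "\<exists>L. (\<forall>i j. j < i \<longrightarrow> L $ i $ j = 0) \<and> (\<forall>i. 0 < L $ i $ i) \<and> P = transpose L ** L"
proof -
  obtain r :: "'n \<Rightarrow> (real, 'n) vec" where
    on: "\<And>i j. r i \<bullet> (P *v r j) = (if i = j then 1 else 0)" and
    ex: "\<And>j. axis j 1 = (\<Sum>k\<in>UNIV. (r k \<bullet> (P *v axis j 1)) *\<^sub>R r k)" and
    pd: "\<And>j. 0 < r j \<bullet> (P *v axis j 1)" and
    tr: "\<And>k j. j < k \<Longrightarrow> r k \<bullet> (P *v axis j 1) = 0"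
    using gram_schmidt[OF assms, of UNIV] by (simp (no_asm_use)) blast
  define L :: "((real, 'n) vec, 'n) vec" where "L = (\<chi> k j. r k \<bullet> (P *v axis j 1))"
  have "P $ i $ j = (transpose L ** L) $ i $ j" for i j
  proof -
    \<comment> \<open>\<open>P\<close> is the Gram matrix of the standard basis for its own inner
      product, here evaluated through coordinates in the orthonormal family.\<close>
    have "P $ i $ j = axis j 1 \<bullet> (P *v axis i 1)"
      using pos_def_inner_commute[OF assms, of "axis i 1" "axis j 1"]
      by (simp add: matrix_vector_mult_basis column_def inner_axis')
    also have "\<dots> = (\<Sum>k\<in>UNIV. (r k \<bullet> (P *v axis j 1)) * (r k \<bullet> (P *v axis i 1)))"
      by (subst ex) (simp add: inner_sum_left)
    finally show ?thesis
      by (simp add: matrix_matrix_mult_def transpose_def L_def mult.commute)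
  qed
  then have "P = transpose L ** L" by (simp add: vec_eq_iff)
  then show ?thesis using pd tr by (intro exI[of _ L]) (auto simp: L_def)
qed

text \<open>\<open>cholesky\<close> and \<open>matrix_inv\<close> are both defined by choice, so
  each needs a witness before anything is known about it. For the inverse, the witness comes from
  injectivity: the factor maps the weighted norm isometrically to the Euclidean one.\<close>

lemma inv_sqrt_inverse:
  fixes P :: "((real, 'n::{finite,linorder}) vec, 'n) vec"
  assumes "pos_def P"
  shows "inv_sqrt P ** cholesky P = mat 1" "cholesky P ** inv_sqrt P = mat 1"
    and "norm (cholesky P *v v) = wnorm P v"
proof -
  let ?L = "cholesky P"
  have P: "P = transpose ?L ** ?L"
    using someI_ex[OF cholesky_exists[OF assms]] unfolding cholesky_def by blast
  have nrm: "norm (?L *v v) = wnorm P v" for v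
  proof -
    have "v \<bullet> (P *v v) = (?L *v v) \<bullet> (?L *v v)"
      by (subst P) (simp flip: matrix_vector_mul_assoc add: inner_commute[of v] dot_lmul_matrix)
    then show ?thesis by (simp add: wnorm_def norm_eq_sqrt_inner)
  qed
  then show "norm (?L *v v) = wnorm P v" .
  have "inj ((*v) ?L)"
    using nrm wnorm_eq_0[OF assms] by (metis linear_injective_0 matrix_vector_mul_linear norm_eq_zero)
  then obtain B where B: "B ** ?L = mat 1"
    using matrix_left_invertible_injective by blast
  then have "?L ** B = mat 1" by (simp add: matrix_left_right_inverse)
  with B have "\<exists>A'. ?L ** A' = mat 1 \<and> A' ** ?L = mat 1" by blast
  from someI_ex[OF this] show "inv_sqrt P ** ?L = mat 1" "?L ** inv_sqrt P = mat 1"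
    unfolding inv_sqrt_def matrix_inv_def by auto
qed

text \<open>Cauchy-Schwarz after inserting the factor and its inverse between the two vectors. The
  norm on the right is the one that occurs in the tightening constants.\<close>

lemma inner_le_inv_sqrt:
  fixes P :: "((real, 'n::{finite,linorder}) vec, 'n) vec"
  assumes "pos_def P"
  shows "g \<bullet> v \<le> norm (g v* inv_sqrt P) * wnorm P v"
proof -
  have "g \<bullet> v = (g v* inv_sqrt P) \<bullet> (cholesky P *v v)"
    by (simp add: dot_lmul_matrix matrix_vector_mul_assoc inv_sqrt_inverse[OF assms])
  also have "\<dots> \<le> norm (g v* inv_sqrt P) * norm (cholesky P *v v)"
    by (rule norm_cauchy_schwarz)
  finally show ?thesis by (simp add: inv_sqrt_inverse[OF assms])
qed

text \<open>Serves to bound the supremum in \<open>tightening\<close>, with no study of how the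
  Cholesky factor depends on the matrix.\<close>

lemma norm_inv_sqrt_le:
  fixes P :: "((real, 'n::{finite,linorder}) vec, 'n) vec"
  assumes "pos_def P" "0 < a" "a *\<^sub>R mat 1 \<preceq>\<^sub>L P"
  shows "norm (g v* inv_sqrt P) \<le> norm g / sqrt a"
proof -
  let ?z = "g v* inv_sqrt P" and ?y = "inv_sqrt P *v (g v* inv_sqrt P)"
  have "sqrt a * norm ?y \<le> wnorm P ?y" by (rule wnorm_ge_lower[OF assms(3)])
  also have "\<dots> = norm ?z"
    by (subst inv_sqrt_inverse(3)[OF assms(1), symmetric])
      (simp add: matrix_vector_mul_assoc inv_sqrt_inverse[OF assms(1)])
  finally have 1: "norm ?y \<le> norm ?z / sqrt a"
    using assms(2) by (simp add: field_simps)
  \<comment> \<open>Duality: pairing \<open>?z\<close> with itself moves the inverse factor onto the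
    other side, where the lower bound on \<open>P\<close> controls it.\<close>
  have "norm ?z * norm ?z = g \<bullet> ?y"
    by (metis dot_lmul_matrix power2_norm_eq_inner power2_eq_square)
  also have "\<dots> \<le> norm g * norm ?y" by (rule norm_cauchy_schwarz)
  also have "\<dots> \<le> norm g * (norm ?z / sqrt a)" using 1 by (rule mult_left_mono) simp
  finally have "norm ?z * norm ?z \<le> norm ?z * (norm g / sqrt a)" by (simp add: mult_ac)
  then show ?thesis
    using assms(2) by (cases "?z = 0") (auto dest: mult_left_le_imp_le simp del: times_divide_eq_right)
qed

section \<open>Curves and their length\<close>

lemma bounded_bilinear_matrix_vector_mult:
  "bounded_bilinear ((*v) :: real^'n^'m \<Rightarrow> real^'n \<Rightarrow> real^'m)"
  unfolding bilinear_conv_bounded_bilinear[symmetric] bilinear_def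
  by (auto intro!: linearI simp: matrix_vector_right_distrib matrix_vector_mult_add_rdistrib
      matrix_vector_mult_scaleR scaleR_matrix_vector_assoc)

lemmas continuous_on_matrix_vector_mult [continuous_intros] =
  bounded_bilinear.continuous_on[OF bounded_bilinear_matrix_vector_mult]

lemma continuous_on_wnorm [continuous_intros]:
  assumes "continuous_on T M" "continuous_on T v"
  shows "continuous_on T (\<lambda>s. wnorm (M s) (v s))"
  unfolding wnorm_def by (intro continuous_intros assms)

lemma velocity_eq:
  assumes "(\<gamma> has_vector_derivative v) (at s within {0..1})" "s \<in> {0..1}"
  shows "velocity \<gamma> s = v"
  unfolding velocity_def using assms by (intro vector_derivative_within_closed_interval) auto

lemma C1_curvesD:
  assumes "\<gamma> \<in> C1_curves a b"
  shows "s \<in> {0..1} \<Longrightarrow> (\<gamma> has_vector_derivative velocity \<gamma> s) (at s within {0..1})"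
    and "continuous_on {0..1} (velocity \<gamma>)"
    and "continuous_on {0..1} \<gamma>"
    and "\<gamma> 0 = a" "\<gamma> 1 = b"
proof -
  obtain \<gamma>' where d: "\<And>s. s \<in> {0..1} \<Longrightarrow> (\<gamma> has_vector_derivative \<gamma>' s) (at s within {0..1})"
    and c: "continuous_on {0..1} \<gamma>'"
    using assms unfolding C1_curves_def by blast
  have e: "s \<in> {0..1} \<Longrightarrow> velocity \<gamma> s = \<gamma>' s" for s using velocity_eq[OF d] by auto
  show "s \<in> {0..1} \<Longrightarrow> (\<gamma> has_vector_derivative velocity \<gamma> s) (at s within {0..1})"
    using d e by auto
  show "continuous_on {0..1} (velocity \<gamma>)" using continuous_on_eq[OF c] e by metis
  show "continuous_on {0..1} \<gamma>"
    using d has_vector_derivative_continuous unfolding continuous_on_eq_continuous_within by blast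
  show "\<gamma> 0 = a" "\<gamma> 1 = b" using assms by (auto simp: C1_curves_def)
qed

lemma C1_curvesI:
  assumes "\<gamma> 0 = a" "\<gamma> 1 = b" "continuous_on {0..1} \<gamma>'"
    "\<And>s. s \<in> {0..1} \<Longrightarrow> (\<gamma> has_vector_derivative \<gamma>' s) (at s within {0..1})"
  shows "\<gamma> \<in> C1_curves a b"
  using assms unfolding C1_curves_def by blast

lemma has_integral_curve_length:
  assumes "\<gamma> \<in> C1_curves a b" "continuous_on UNIV M"
  shows "((\<lambda>s. wnorm (M (\<gamma> s)) (velocity \<gamma> s)) has_integral curve_length M \<gamma>) {0..1}"
  unfolding curve_length_def
  by (intro integrable_integral integrable_continuous_real continuous_intros C1_curvesD(2)[OF assms(1)]
      continuous_on_compose2[OF assms(2) C1_curvesD(3)[OF assms(1)]]) auto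

lemma curve_length_nonneg:
  assumes "\<gamma> \<in> C1_curves a b" "continuous_on UNIV M" "\<And>x. pos_def (M x)"
  shows "0 \<le> curve_length M \<gamma>"
  using has_integral_curve_length[OF assms(1,2)]
  by (rule has_integral_nonneg) (use wnorm_nonneg assms(3) in auto)

lemma segment_C1_curve: "(\<lambda>s. a + s *\<^sub>R (b - a)) \<in> C1_curves a b"
  by (rule C1_curvesI[where \<gamma>' = "\<lambda>s. b - a"]) (auto intro!: derivative_eq_intros continuous_intros)

lemma segment_length_le:
  assumes "continuous_on UNIV M"
    and "\<And>s. s \<in> {0..1} \<Longrightarrow> wnorm (M (a + s *\<^sub>R (b - a))) (b - a) \<le> B"
  shows "curve_length M (\<lambda>s. a + s *\<^sub>R (b - a)) \<le> B"
proof -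
  have "velocity (\<lambda>s. a + s *\<^sub>R (b - a)) s = b - a" if "s \<in> {0..1}" for s
    by (rule velocity_eq) (use that in \<open>auto intro!: derivative_eq_intros\<close>)
  then show ?thesis
    using has_integral_le[OF has_integral_curve_length[OF segment_C1_curve assms(1)]
        has_integral_const_real[of B 0 1]] assms(2) by simp
qed

text \<open>The squared positive part is a C1 function that is constant on one side of 0. It is the
  building block for a parametrization that comes to rest at a junction.\<close>

lemma has_real_derivative_max_square:
  "((\<lambda>x::real. (max 0 x)\<^sup>2) has_real_derivative 2 * max 0 x) (at x within T)"
proof (cases x "0::real" rule: linorder_cases)
  case less
  have "((\<lambda>x::real. 0) has_real_derivative 0) (at x)" by simp
  then have "((\<lambda>x::real. (max 0 x)\<^sup>2) has_real_derivative 0) (at x)"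
    by (rule has_field_derivative_transform_within_open[where S = "{..<0}"]) (use less in auto)
  then show ?thesis using less by (auto intro: has_field_derivative_at_within)
next
  case equal
  have "((\<lambda>h::real. (max 0 h)\<^sup>2 / h) \<longlongrightarrow> 0) (at 0)"
  proof (rule Lim_null_comparison)
    show "\<forall>\<^sub>F h in at (0::real). norm ((max 0 h)\<^sup>2 / h) \<le> \<bar>h\<bar>"
      by (intro always_eventually allI) (auto simp: max_def power2_eq_square)
    show "((\<lambda>h::real. \<bar>h\<bar>) \<longlongrightarrow> 0) (at 0)"
      by (rule tendsto_eq_intros refl)+ simp
  qed
  then have "((\<lambda>x::real. (max 0 x)\<^sup>2) has_real_derivative 0) (at 0)"
    by (simp add: has_field_derivative_iff)
  then show ?thesis using equal by (auto intro: has_field_derivative_at_within)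
next
  case greater
  have "((\<lambda>x::real. x\<^sup>2) has_real_derivative 2 * x) (at x)"
    by (auto intro!: derivative_eq_intros)
  then have "((\<lambda>x::real. (max 0 x)\<^sup>2) has_real_derivative 2 * x) (at x)"
    by (rule has_field_derivative_transform_within_open[where S = "{0<..}"]) (use greater in auto)
  then show ?thesis using greater by (auto intro: has_field_derivative_at_within)
qed

text \<open>The two curves are run through one after the other, each with a parametrization whose speed
  vanishes at the junction; this keeps the concatenation continuously differentiable.\<close>

lemma C1_curves_concat:
  assumes g1: "\<gamma>1 \<in> C1_curves a b" and g2: "\<gamma>2 \<in> C1_curves b c" and M: "continuous_on UNIV M"
  shows "\<exists>\<gamma>\<in>C1_curves a c. curve_length M \<gamma> = curve_length M \<gamma>1 + curve_length M \<gamma>2"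
proof -
  \<comment> \<open>\<open>p\<close> runs from 0 to 1 during the first half and then rests at 1;
    \<open>q\<close> rests at 0 and runs during the second half.\<close>
  define p where "p = (\<lambda>s::real. 1 - (max 0 (1 - 2 * s))\<^sup>2)"
  define q where "q = (\<lambda>s::real. (max 0 (2 * s - 1))\<^sup>2)"
  define p' where "p' = (\<lambda>s::real. 4 * max 0 (1 - 2 * s))"
  define q' where "q' = (\<lambda>s::real. 4 * max 0 (2 * s - 1))"
  have dp: "(p has_real_derivative p' s) (at s within T)" for s T
  proof -
    have "((\<lambda>s::real. 1 - 2 * s) has_real_derivative - 2) (at s within T)"
      by (auto intro!: derivative_eq_intros)
    from DERIV_diff[OF DERIV_const[of 1] DERIV_chain2[OF has_real_derivative_max_square this]]
    show ?thesis unfolding p_def p'_def by simp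
  qed
  have dq: "(q has_real_derivative q' s) (at s within T)" for s T
  proof -
    have "((\<lambda>s::real. 2 * s - 1) has_real_derivative 2) (at s within T)"
      by (auto intro!: derivative_eq_intros)
    from DERIV_chain2[OF has_real_derivative_max_square this]
    show ?thesis unfolding q_def q'_def by simp
  qed
  have p'0: "0 \<le> p' s" and q'0: "0 \<le> q' s" for s by (auto simp: p'_def q'_def)
  have p01: "p ` {0..1} \<subseteq> {0..1}" and q01: "q ` {0..1} \<subseteq> {0..1}"
    by (auto simp: p_def q_def max_def abs_square_le_1[unfolded power2_abs])
  \<comment> \<open>At every time at least one of the two summands is resting at the junction
    \<open>b\<close>, so subtracting \<open>b\<close> leaves the moving one. A single formula on the
    whole interval avoids gluing derivatives at 1/2.\<close>
  define \<eta> where "\<eta> = (\<lambda>s. \<gamma>1 (p s) + \<gamma>2 (q s) - b)"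
  define v where "v = (\<lambda>s. p' s *\<^sub>R velocity \<gamma>1 (p s) + q' s *\<^sub>R velocity \<gamma>2 (q s))"
  have chain: "((\<lambda>s. \<gamma> (r s)) has_vector_derivative r' *\<^sub>R velocity \<gamma> (r s)) (at s within {0..1})"
    if "\<gamma> \<in> C1_curves u w" "r ` {0..1} \<subseteq> {0..1}" "s \<in> {0..1}"
      "(r has_real_derivative r') (at s within {0..1})" for \<gamma> :: "real \<Rightarrow> real^'n" and u w r r' s
  proof -
    have "r s \<in> {0..1}" using that(2,3) by blast
    with that show ?thesis
      using vector_diff_chain_within[of r r' s "{0..1}" \<gamma> "velocity \<gamma> (r s)"]
        has_vector_derivative_within_subset[OF C1_curvesD(1)[OF that(1)], of "r s" "r ` {0..1}"]
      by (simp add: o_def has_real_derivative_iff_has_vector_derivative)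
  qed
  have d\<eta>: "(\<eta> has_vector_derivative v s) (at s within {0..1})" if "s \<in> {0..1}" for s
    unfolding \<eta>_def v_def
    by (rule derivative_eq_intros chain[OF g1 p01 that dp] chain[OF g2 q01 that dq] refl | simp)+
  have cp: "continuous_on T p" "continuous_on T p'" and cq: "continuous_on T q" "continuous_on T q'" for T
    unfolding p_def q_def p'_def q'_def by (intro continuous_intros)+
  have \<eta>: "\<eta> \<in> C1_curves a c"
  proof (rule C1_curvesI[OF _ _ _ d\<eta>])
    show "\<eta> 0 = a" "\<eta> 1 = c"
      using C1_curvesD(4,5)[OF g1] C1_curvesD(4,5)[OF g2] by (auto simp: \<eta>_def p_def q_def)
    show "continuous_on {0..1} v"
      unfolding v_def
      by (intro continuous_intros cp cq continuous_on_compose2[OF C1_curvesD(2)[OF g1] _ p01]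
          continuous_on_compose2[OF C1_curvesD(2)[OF g2] _ q01])
  qed
  define F1 where "F1 = (\<lambda>s. wnorm (M (\<gamma>1 s)) (velocity \<gamma>1 s))"
  define F2 where "F2 = (\<lambda>s. wnorm (M (\<gamma>2 s)) (velocity \<gamma>2 s))"
  have cF: "continuous_on {0..1} F1" "continuous_on {0..1} F2"
    unfolding F1_def F2_def
    by (intro continuous_intros continuous_on_compose2[OF M] C1_curvesD[OF g1] C1_curvesD[OF g2]; simp)+
  have h1: "0 \<le> s \<Longrightarrow> s \<le> 1/2 \<Longrightarrow> wnorm (M (\<eta> s)) (velocity \<eta> s) = p' s *\<^sub>R F1 (p s)" for s
    using velocity_eq[OF d\<eta>] C1_curvesD(4)[OF g2] p'0[of s]
    by (simp add: F1_def \<eta>_def v_def wnorm_scaleR q_def q'_def)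
  have h2: "1/2 \<le> s \<Longrightarrow> s \<le> 1 \<Longrightarrow> wnorm (M (\<eta> s)) (velocity \<eta> s) = q' s *\<^sub>R F2 (q s)" for s
    using velocity_eq[OF d\<eta>] C1_curvesD(5)[OF g1] q'0[of s]
    by (simp add: F2_def \<eta>_def v_def wnorm_scaleR p_def p'_def)
  have "((\<lambda>s. p' s *\<^sub>R F1 (p s)) has_integral integral {p 0..p (1/2)} F1) {0..1/2}"
    by (rule has_integral_substitution[OF _ _ order_trans[OF image_mono p01] cF(1) dp]) (auto simp: p_def)
  then have i1: "((\<lambda>s. wnorm (M (\<eta> s)) (velocity \<eta> s)) has_integral curve_length M \<gamma>1) {0..1/2}"
    using h1 by (subst has_integral_cong[where g = "\<lambda>s. p' s *\<^sub>R F1 (p s)"])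
      (auto simp: curve_length_def F1_def p_def)
  have "((\<lambda>s. q' s *\<^sub>R F2 (q s)) has_integral integral {q (1/2)..q 1} F2) {1/2..1}"
    by (rule has_integral_substitution[OF _ _ order_trans[OF image_mono q01] cF(2) dq]) (auto simp: q_def)
  then have i2: "((\<lambda>s. wnorm (M (\<eta> s)) (velocity \<eta> s)) has_integral curve_length M \<gamma>2) {1/2..1}"
    using h2 by (subst has_integral_cong[where g = "\<lambda>s. q' s *\<^sub>R F2 (q s)"])
      (auto simp: curve_length_def F2_def q_def)
  have "curve_length M \<eta> = curve_length M \<gamma>1 + curve_length M \<gamma>2"
    using has_integral_combine[OF _ _ i1 i2] has_integral_curve_length[OF \<eta> M]
    by (auto intro: has_integral_unique)
  with \<eta> show ?thesis by blast
qed

section \<open>Tubes around nominal points\<close>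

lemma inner_gradient:
  assumes "(q has_derivative D) (at x)"
  shows "gradient q x \<bullet> v = D v"
proof -
  have l: "linear D" using assms by (rule has_derivative_linear)
  have "D v = D (\<Sum>i\<in>UNIV. (v $ i) *\<^sub>R axis i 1)"
    using basis_expansion[of v] by (simp add: scalar_mult_eq_scaleR)
  also have "\<dots> = (\<Sum>i\<in>UNIV. v $ i * D (axis i 1))"
    by (simp add: linear_sum[OF l] linear_scale[OF l])
  finally show ?thesis
    by (simp add: gradient_def inner_vec_def frechet_derivative_at[OF assms, symmetric] mult.commute)
qed

locale tube_mpc =
  fixes S :: "('nx::{finite,linorder}, 'ne::finite, 'nu::finite, 'd::finite, 'j::finite) setting"
  assumes system: "system_assms S"
    and learned: "learned_assms S"
    and geodesics: "geodesic_selection S"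
    and mpc: "mpc_assms S"
    and regular: "untightened_regular S"
    and contraction: "rccm S"
    and error_bound: "peb S"
    and term_ctrl_eq: "term_ctrl S = (\<lambda>xb. 0)"
    and term_cost_eq: "term_cost S = (\<lambda>xb \<delta>. weightD S / rho_c S * \<delta>\<^sup>2)"
    and term_set_eq: "term_set S = {(xb, \<delta>). 0 \<le> \<delta> \<and> xb = 0 \<and>
           (\<forall>j. hcon S j xb (term_ctrl S xb) + tightening S j * \<delta> \<le> 0)}"
begin

abbreviation "Z \<equiv> Zset S"
abbreviation "M \<equiv> metric S"
abbreviation "K \<equiv> gain S"

lemma metric_pos_def: "pos_def (M x)"
  and gain_continuous: "continuous_on UNIV K"
  and rho: "0 < rho_c S" "rho_c S < 1" and alpha: "0 < alpha1 S" "0 < alpha2 S"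
  using contraction unfolding rccm_def by auto

lemma metric_continuous: "continuous_on UNIV M"
proof -
  obtain M' where "\<And>x. (M has_derivative blinfun_apply (M' x)) (at x)"
    using contraction unfolding rccm_def continuously_differentiable_def by blast
  then show ?thesis by (rule has_derivative_continuous_on)
qed

lemma Z_compact: "compact Z" and Z_sub: "(x, u) \<in> Z \<Longrightarrow> x \<in> state_set S \<and> u \<in> input_set S"
  and Z_zero: "(0, 0) \<in> Z" and hcon_zero: "hcon S j 0 0 < 0"
  using system by (auto simp: system_assms_def Zset_def less_imp_le)

lemma Z_iff: "(x, u) \<in> Z \<longleftrightarrow> (\<forall>j. hcon S j x u \<le> 0)"
  by (simp add: Zset_def)

lemma zero_in_Dset: "0 \<in> Dset"
  unfolding Dset_def
  by (auto intro!: exI[of _ 0] simp: join_vec_def kron_vec_def vec_eq_iff split: sum.splits)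

lemma rccm_D:
  assumes "(x, u) \<in> Z" "w \<in> Dset"
  shows "transpose (Acl S x u w) ** M (fw S x u w) ** Acl S x u w \<preceq>\<^sub>L (1 - rho_c S) *\<^sub>R M x"
    and "M (fw S x u w) \<preceq>\<^sub>L alpha2 S *\<^sub>R mat 1"
  using contraction assms unfolding rccm_def by blast+

lemma Z_metric_bounds:
  assumes "(x, u) \<in> Z"
  shows "alpha1 S *\<^sub>R mat 1 \<preceq>\<^sub>L M x" "M x \<preceq>\<^sub>L alpha2 S *\<^sub>R mat 1"
  using contraction assms zero_in_Dset unfolding rccm_def by blast+

section \<open>Slope of the constraint functions along tube curves\<close>

definition Dh where
  "Dh = (SOME D. (\<forall>j p. ((\<lambda>(x, u). hcon S j x u) has_derivative blinfun_apply (D j p)) (at p)) \<and>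
     (\<forall>j. continuous_on UNIV (D j)))"

lemma Dh: "((\<lambda>(x, u). hcon S j x u) has_derivative blinfun_apply (Dh j p)) (at p)"
  and Dh_continuous: "continuous_on UNIV (Dh j)"
proof -
  have "\<exists>D. (\<forall>j p. ((\<lambda>(x, u). hcon S j x u) has_derivative blinfun_apply (D j p)) (at p)) \<and>
     (\<forall>j. continuous_on UNIV (D j))"
    using system unfolding system_assms_def continuously_differentiable_def by metis
  from someI_ex[OF this, folded Dh_def]
  show "((\<lambda>(x, u). hcon S j x u) has_derivative blinfun_apply (Dh j p)) (at p)"
    "continuous_on UNIV (Dh j)" by blast+
qed

lemma hcon_continuous: "continuous_on UNIV (\<lambda>p. hcon S j (fst p) (snd p))"
  using has_derivative_continuous_on[OF Dh[THEN has_derivative_at_withinI], of UNIV j]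
  by (simp add: case_prod_beta')

definition hgrad where
  "hgrad j x u = gradient (\<lambda>x'. hcon S j x' u) x + gradient (\<lambda>u'. hcon S j x u') u v* K x"

text \<open>Links the partial gradients in the definition of the tightening constants to the joint
  derivative needed by the chain rule: if the state moves with velocity \<open>v\<close> and the
  input with velocity \<open>K x *v v\<close>, this is the rate of change of the constraint
  function.\<close>

lemma inner_hgrad: "hgrad j x u \<bullet> v = Dh j (x, u) (v, K x *v v)"
proof -
  have "((\<lambda>x'. hcon S j x' u) has_derivative (\<lambda>a. Dh j (x, u) (a, 0))) (at x)"
    using has_derivative_compose[OF has_derivative_Pair[OF has_derivative_ident has_derivative_const] Dh, of j u x UNIV]
    by simp
  moreover have "((\<lambda>u'. hcon S j x u') has_derivative (\<lambda>b. Dh j (x, u) (0, b))) (at u)"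
    using has_derivative_compose[OF has_derivative_Pair[OF has_derivative_const has_derivative_ident] Dh, of j x u UNIV]
    by simp
  ultimately have "hgrad j x u \<bullet> v = Dh j (x, u) (v, 0) + Dh j (x, u) (0, K x *v v)"
    by (simp add: hgrad_def inner_add_left dot_lmul_matrix inner_gradient)
  then show ?thesis by (simp flip: blinfun.add_right)
qed

lemma norm_hgrad_bounded: "\<exists>B. \<forall>(x, u)\<in>Z. norm (hgrad j x u) \<le> B"
proof -
  obtain C where C: "0 < C" "\<And>(A::((real, 'nx) vec, 'nu) vec) v. norm (A *v v) \<le> norm A * norm v * C"
    using bounded_bilinear.pos_bounded[OF bounded_bilinear_matrix_vector_mult] by blast
  define b where "b = (\<lambda>p. norm (Dh j p) * (1 + norm (K (fst p)) * C))"
  have le: "norm (hgrad j x u) \<le> b (x, u)" for x u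
  proof -
    let ?g = "hgrad j x u"
    \<comment> \<open>Pairing the gradient with itself turns the operator norm of the joint
      derivative, which is continuous in the point, into a bound on the gradient.\<close>
    have "norm ?g * norm ?g = Dh j (x, u) (?g, K x *v ?g)"
      by (metis inner_hgrad power2_norm_eq_inner power2_eq_square)
    also have "\<dots> \<le> norm (Dh j (x, u)) * norm (?g, K x *v ?g)"
      using norm_blinfun by (metis abs_le_D1 real_norm_def)
    also have "\<dots> \<le> norm (Dh j (x, u)) * (norm ?g + norm (K x) * norm ?g * C)"
      using norm_Pair_le[of ?g "K x *v ?g"] C(2)[of "K x" ?g] by (intro mult_left_mono) auto
    finally have "norm ?g * norm ?g \<le> norm ?g * b (x, u)"
      by (simp add: b_def algebra_simps)
    moreover have "0 \<le> b (x, u)" using C by (simp add: b_def)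
    ultimately show ?thesis
      by (cases "?g = 0") (auto dest: mult_left_le_imp_le)
  qed
  have "continuous_on Z b"
    unfolding b_def
    by (intro continuous_intros continuous_on_subset[OF Dh_continuous] continuous_on_compose2[OF gain_continuous]) auto
  then have "bounded (b ` Z)"
    using Z_compact compact_continuous_image compact_imp_bounded by blast
  then obtain B where "\<And>p. p \<in> Z \<Longrightarrow> norm (b p) \<le> B"
    unfolding bounded_iff by blast
  then have "\<forall>(x, u)\<in>Z. norm (hgrad j x u) \<le> B"
    using le by (fastforce intro: order_trans)
  then show ?thesis by blast
qed

text \<open>A real supremum dominates its members only if they are bounded above. Compactness of
  \<open>Z\<close> bounds the gradients, and the uniform lower bound on the metric bounds the
  inverse factors.\<close>

lemma norm_hgrad_le_tightening:
  assumes "(x, u) \<in> Z"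
  shows "norm (hgrad j x u v* inv_sqrt (M x)) \<le> tightening S j"
proof -
  obtain B where B: "\<And>x u. (x, u) \<in> Z \<Longrightarrow> norm (hgrad j x u) \<le> B"
    using norm_hgrad_bounded by (metis (no_types, lifting) case_prodD)
  have "norm (hgrad j x u v* inv_sqrt (M x)) \<le> B / sqrt (alpha1 S)" if "(x, u) \<in> Z" for x u
    using norm_inv_sqrt_le[OF metric_pos_def alpha(1) Z_metric_bounds(1)[OF that]]
      divide_right_mono[OF B[OF that] real_sqrt_ge_zero] alpha(1) by (meson less_imp_le order_trans)
  then have "bdd_above ((\<lambda>(x, u). norm (hgrad j x u v* inv_sqrt (M x))) ` Z)"
    by (intro bdd_aboveI[where M = "B / sqrt (alpha1 S)"]) auto
  from cSUP_upper[OF assms this] show ?thesis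
    by (simp add: tightening_def hgrad_def)
qed

lemma tightening_nonneg: "0 \<le> tightening S j"
  using norm_hgrad_le_tightening[OF Z_zero] norm_ge_zero order_trans by blast

lemma hcon_slope_le:
  assumes "(x, u) \<in> Z"
  shows "Dh j (x, u) (v, K x *v v) \<le> tightening S j * wnorm (M x) v"
proof -
  have "Dh j (x, u) (v, K x *v v) \<le> norm (hgrad j x u v* inv_sqrt (M x)) * wnorm (M x) v"
    unfolding inner_hgrad[symmetric] by (rule inner_le_inv_sqrt[OF metric_pos_def])
  also have "\<dots> \<le> tightening S j * wnorm (M x) v"
    by (intro mult_right_mono norm_hgrad_le_tightening assms wnorm_nonneg metric_pos_def)
  finally show ?thesis .
qed

text \<open>First exit time argument: as long as the curve has not left the constraint set, the constraint
  functions grow at most at the rate given by the tightening constants.\<close>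

lemma strict_tube:
  assumes t: "t \<in> {0..1}"
    and d\<gamma>: "\<And>s. s \<in> {0..1} \<Longrightarrow> (\<gamma> has_vector_derivative v s) (at s within {0..1})"
    and d\<upsilon>: "\<And>s. s \<in> {0..1} \<Longrightarrow> (\<upsilon> has_vector_derivative K (\<gamma> s) *v v s) (at s within {0..1})"
    and cv: "continuous_on {0..1} v"
    and strict: "\<And>j. hcon S j (\<gamma> 0) (\<upsilon> 0)
      + tightening S j * integral {0..t} (\<lambda>s. wnorm (M (\<gamma> s)) (v s)) < 0"
  shows "(\<gamma> t, \<upsilon> t) \<in> Z"
proof -
  let ?f = "\<lambda>s. wnorm (M (\<gamma> s)) (v s)"
  define L where "L = (\<lambda>s. integral {0..s} ?f)"
  have c\<gamma>: "continuous_on {0..1} \<gamma>" and c\<upsilon>: "continuous_on {0..1} \<upsilon>"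
    using d\<gamma> d\<upsilon> has_vector_derivative_continuous unfolding continuous_on_eq_continuous_within by blast+
  have cf: "continuous_on {0..1} ?f"
    by (intro continuous_intros continuous_on_compose2[OF metric_continuous c\<gamma>] cv) auto
  have dL: "(L has_vector_derivative ?f s) (at s within {0..1})" if "s \<in> {0..1}" for s
    unfolding L_def by (rule integral_has_vector_derivative[OF cf that])
  have cL: "continuous_on {0..1} L"
    using dL has_vector_derivative_continuous unfolding continuous_on_eq_continuous_within by blast
  have Lmono: "L s \<le> L t" if "0 \<le> s" "s \<le> t" for s
  proof -
    have "L t = L s + integral {s..t} ?f"
      unfolding L_def using that t
      by (intro Henstock_Kurzweil_Integration.integral_combine[symmetric] integrable_continuous_real
          continuous_on_subset[OF cf]) auto
    moreover have "0 \<le> integral {s..t} ?f"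
      by (rule integral_nonneg) (use that t in \<open>auto intro!: integrable_continuous_real
          continuous_on_subset[OF cf] wnorm_nonneg metric_pos_def\<close>)
    ultimately show ?thesis by simp
  qed
  have ch: "continuous_on {0..1} (\<lambda>s. hcon S j (\<gamma> s) (\<upsilon> s))" for j
    using continuous_on_compose2[OF hcon_continuous continuous_on_Pair[OF c\<gamma> c\<upsilon>]] by simp
  \<comment> \<open>The inequality is weak so that the set is closed and has a first element;
    strictly before that element all constraints are negative.\<close>
  define bad where "bad = (\<Union>j. {s \<in> {0..t}. 0 \<le> hcon S j (\<gamma> s) (\<upsilon> s)})"
  have "closed {s \<in> {0..t}. 0 \<le> hcon S j (\<gamma> s) (\<upsilon> s)}" for j
    by (rule continuous_on_closed_Collect_le[where f = "\<lambda>_. 0"])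
      (use t in \<open>auto intro: continuous_on_subset[OF ch]\<close>)
  then have "closed bad" unfolding bad_def by (intro closed_UN) auto
  moreover have "bounded bad" by (rule bounded_subset[of "{0..t}"]) (auto simp: bad_def)
  ultimately have "compact bad" using compact_eq_bounded_closed by blast
  have "bad = {}"
  proof (rule ccontr)
    assume "bad \<noteq> {}"
    then obtain s0 where s0: "s0 \<in> bad" "\<And>s. s \<in> bad \<Longrightarrow> s0 \<le> s"
      using compact_attains_inf[OF \<open>compact bad\<close>] by blast
    then obtain j where j: "0 \<le> hcon S j (\<gamma> s0) (\<upsilon> s0)" and s0t: "0 \<le> s0" "s0 \<le> t"
      by (auto simp: bad_def)
    have inZ: "(\<gamma> s, \<upsilon> s) \<in> Z" if "0 \<le> s" "s < s0" for s
    proof -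
      have "s \<notin> bad" using s0(2)[of s] that by auto
      then show ?thesis using that s0t by (auto simp: bad_def Z_iff not_le intro: less_imp_le)
    qed
    \<comment> \<open>Before the first bad time the slope bound applies, so \<open>?\<phi>\<close>
      cannot increase. At \<open>s0\<close> the constraint function is then at most its initial
      value plus the allowed growth up to \<open>t\<close>, which \<open>strict\<close> makes
      negative.\<close>
    let ?\<phi> = "\<lambda>s. hcon S j (\<gamma> s) (\<upsilon> s) - tightening S j * L s"
    have "?\<phi> s0 \<le> ?\<phi> 0"
    proof (rule DERIV_nonpos_imp_decreasing_open[OF s0t(1)])
      show "continuous_on {0..s0} ?\<phi>"
        by (rule continuous_on_subset[of "{0..1}"]) (use s0t t in \<open>auto intro!: continuous_intros ch cL\<close>)
      fix s assume s: "0 < s" "s < s0"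
      then have s1: "s \<in> {0..1}" "s < 1" using s0t t by auto
      then have at: "at s within {0..1} = at s" using s by (simp add: at_within_Icc_at)
      have "((\<lambda>s. (\<gamma> s, \<upsilon> s)) has_derivative (\<lambda>r. (r *\<^sub>R v s, r *\<^sub>R (K (\<gamma> s) *v v s)))) (at s)"
        using d\<gamma>[OF s1(1)] d\<upsilon>[OF s1(1)] unfolding at has_vector_derivative_def by (rule has_derivative_Pair)
      from has_derivative_compose[OF this Dh, of j]
      have "((\<lambda>s. hcon S j (\<gamma> s) (\<upsilon> s)) has_derivative
          (\<lambda>r. Dh j (\<gamma> s, \<upsilon> s) (r *\<^sub>R v s, r *\<^sub>R (K (\<gamma> s) *v v s)))) (at s)"
        by simp
      then have "((\<lambda>s. hcon S j (\<gamma> s) (\<upsilon> s)) has_real_derivative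
          Dh j (\<gamma> s, \<upsilon> s) (v s, K (\<gamma> s) *v v s)) (at s)"
        by (simp add: has_field_derivative_def blinfun.scaleR_right mult_commute_abs flip: scaleR_Pair)
      moreover have "(L has_real_derivative ?f s) (at s)"
        using dL[OF s1(1)] by (simp add: at has_real_derivative_iff_has_vector_derivative)
      ultimately have "(?\<phi> has_real_derivative
          Dh j (\<gamma> s, \<upsilon> s) (v s, K (\<gamma> s) *v v s) - tightening S j * ?f s) (at s)"
        by (intro DERIV_diff DERIV_cmult)
      moreover have "Dh j (\<gamma> s, \<upsilon> s) (v s, K (\<gamma> s) *v v s) - tightening S j * ?f s \<le> 0"
        using hcon_slope_le[OF inZ] s by simp
      ultimately show "\<exists>y. (?\<phi> has_real_derivative y) (at s) \<and> y \<le> 0" by blast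
    qed
    moreover have "L 0 = 0" by (simp add: L_def)
    moreover have "tightening S j * L s0 \<le> tightening S j * L t"
      by (intro mult_left_mono Lmono s0t tightening_nonneg)
    ultimately show False using strict[of j] j by (simp add: L_def)
  qed
  then have "hcon S j (\<gamma> t) (\<upsilon> t) \<le> 0" for j
    using t unfolding bad_def by (metis (mono_tags, lifting) UN_I UNIV_I atLeastAtMost_iff empty_iff
        linear mem_Collect_eq)
  then show ?thesis by (simp add: Z_iff)
qed

text \<open>Translating the curve so that it starts at a point where the untightened constraints are strict
  makes all constraints strict along the whole piece of curve.\<close>

lemma tube_before_end:
  assumes \<gamma>: "\<gamma> \<in> C1_curves xb x" and t: "t \<in> {0..1}"
    and feas: "\<And>j. hcon S j xb ub + tightening S j * \<delta> \<le> 0"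
    and Lt: "integral {0..t} (\<lambda>s. wnorm (M (\<gamma> s)) (velocity \<gamma> s)) < \<delta>" and \<delta>: "0 \<le> \<delta>"
  shows "(\<gamma> t, ub + integral {0..t} (\<lambda>s. K (\<gamma> s) *v velocity \<gamma> s)) \<in> Z"
proof -
  note cv = C1_curvesD(2)[OF \<gamma>] and c\<gamma> = C1_curvesD(3)[OF \<gamma>]
  have "(xb, ub) \<in> Z"
    using feas mult_nonneg_nonneg[OF tightening_nonneg \<delta>] unfolding Z_iff by (smt (verit))
  then have "(xb, ub) \<in> closure {(x, u). \<forall>j. tightening S j = 0 \<longrightarrow> hcon S j x u < 0}"
    using regular unfolding untightened_regular_def by blast
  then obtain p where p: "\<And>n. p n \<in> {(x, u). \<forall>j. tightening S j = 0 \<longrightarrow> hcon S j x u < 0}"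
    and plim: "p \<longlonglongrightarrow> (xb, ub)"
    unfolding closure_sequential by blast
  \<comment> \<open>Length and accumulated input of the curve translated by \<open>e\<close>. The
    metric and the gain are evaluated at the translated points, so both vary with \<open>e\<close>,
    continuously as parameter integrals over a compact interval.\<close>
  define L where "L = (\<lambda>e. integral {0..t} (\<lambda>s. wnorm (M (\<gamma> s + e)) (velocity \<gamma> s)))"
  define G where "G = (\<lambda>e s. integral {0..s} (\<lambda>s. K (\<gamma> s + e) *v velocity \<gamma> s))"
  define e where "e = (\<lambda>n. fst (p n) - xb)"
  define w where "w = (\<lambda>n. snd (p n))"
  have elim: "e \<longlonglongrightarrow> 0" using tendsto_fst[OF plim] by (simp add: e_def LIM_zero)
  have wlim: "w \<longlonglongrightarrow> ub" using tendsto_snd[OF plim] by (simp add: w_def)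
  have sub: "{0..t} \<subseteq> {0..1}" using t by auto
  have snd_in: "snd ` (A \<times> {0..t}) \<subseteq> {0..1}" for A :: "(real, 'nx) vec set" using t by auto
  note ci = continuous_intros continuous_on_compose2[OF cv _ snd_in] continuous_on_compose2[OF c\<gamma> _ snd_in]
  have cL: "continuous_on UNIV L"
    unfolding L_def cbox_interval[symmetric]
    by (rule integral_continuous_on_param, simp add: case_prod_unfold)
      (intro ci continuous_on_compose2[OF metric_continuous] subset_UNIV)
  have cG: "continuous_on UNIV (\<lambda>e. G e t)"
    unfolding G_def cbox_interval[symmetric]
    by (rule integral_continuous_on_param, simp add: case_prod_unfold)
      (intro ci continuous_on_compose2[OF gain_continuous] subset_UNIV)
  have Llim: "(\<lambda>n. L (e n)) \<longlonglongrightarrow> L 0" and Glim: "(\<lambda>n. G (e n) t) \<longlonglongrightarrow> G 0 t"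
    using continuous_on_tendsto_compose[OF cL elim] continuous_on_tendsto_compose[OF cG elim] by auto
  have hlim: "(\<lambda>n. hcon S j (fst (p n)) (snd (p n))) \<longlonglongrightarrow> hcon S j xb ub" for j
    using continuous_on_tendsto_compose[OF hcon_continuous plim] by auto
  have "\<forall>\<^sub>F n in sequentially. hcon S j (fst (p n)) (snd (p n)) + tightening S j * L (e n) < 0" for j
  \<comment> \<open>Without tightening, strictness holds at the chosen starting point itself. With
    tightening, it holds at the original point because the length is below \<delta>, and it survives
    small translations.\<close>
  proof (cases "tightening S j = 0")
    case True
    then show ?thesis using p by (auto simp: case_prod_unfold)
  next
    case False
    then have "tightening S j * L 0 < tightening S j * \<delta>"
      using Lt tightening_nonneg[of j] by (auto simp: L_def intro!: mult_strict_left_mono)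
    then have "hcon S j xb ub + tightening S j * L 0 < 0" using feas[of j] by linarith
    then show ?thesis
      by (rule order_tendstoD(2)[OF tendsto_add[OF hlim tendsto_mult[OF tendsto_const Llim]]])
  qed
  then have "\<forall>\<^sub>F n in sequentially. \<forall>j. hcon S j (fst (p n)) (snd (p n)) + tightening S j * L (e n) < 0"
    by (rule eventually_all_finite)
  then have "\<forall>\<^sub>F n in sequentially. (\<gamma> t + e n, w n + G (e n) t) \<in> Z"
  proof (rule eventually_mono)
    fix n assume n: "\<forall>j. hcon S j (fst (p n)) (snd (p n)) + tightening S j * L (e n) < 0"
    show "(\<gamma> t + e n, w n + G (e n) t) \<in> Z"
    proof (rule strict_tube[OF t])
      show "continuous_on {0..1} (velocity \<gamma>)" by (rule cv)
      show "hcon S j (\<gamma> 0 + e n) (w n + G (e n) 0)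
        + tightening S j * integral {0..t} (\<lambda>s. wnorm (M (\<gamma> s + e n)) (velocity \<gamma> s)) < 0" for j
        using n C1_curvesD(4)[OF \<gamma>] by (simp add: e_def w_def G_def L_def)
      fix s :: real assume s: "s \<in> {0..1}"
      show "((\<lambda>s. \<gamma> s + e n) has_vector_derivative velocity \<gamma> s) (at s within {0..1})"
        using has_vector_derivative_add[OF C1_curvesD(1)[OF \<gamma> s] has_vector_derivative_const] by simp
      have "continuous_on {0..1} (\<lambda>s. K (\<gamma> s + e n) *v velocity \<gamma> s)"
        by (intro continuous_intros cv c\<gamma> continuous_on_compose2[OF gain_continuous] subset_UNIV)
      from integral_has_vector_derivative[OF this s]
      show "((\<lambda>s. w n + G (e n) s) has_vector_derivative K (\<gamma> s + e n) *v velocity \<gamma> s) (at s within {0..1})"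
        using has_vector_derivative_add[OF has_vector_derivative_const] by (fastforce simp: G_def)
    qed
  qed
  moreover have "(\<lambda>n. (\<gamma> t + e n, w n + G (e n) t)) \<longlonglongrightarrow> (\<gamma> t + 0, ub + G 0 t)"
    by (intro tendsto_intros elim wlim Glim)
  ultimately have "(\<gamma> t + 0, ub + G 0 t) \<in> Z"
    by (rule Lim_in_closed_set[OF compact_imp_closed[OF Z_compact] _ sequentially_bot])
  then show ?thesis by (simp add: G_def)
qed

end

section \<open>Derivative of the uncertain predictor\<close>

lemma sum_UNIV_Plus:
  "(\<Sum>p\<in>UNIV. f p) = (\<Sum>i\<in>UNIV. f (Inl i)) + (\<Sum>j\<in>UNIV. f (Inr j))"
  for f :: "'a::finite + 'b::finite \<Rightarrow> 'c::comm_monoid_add"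
  unfolding UNIV_Plus_UNIV[symmetric] by (subst sum.Plus) (auto simp: o_def)

lemma join_vec_nth [simp]: "join_vec v w $ Inl i = v $ i" "join_vec v w $ Inr j = w $ j"
  by (simp_all add: join_vec_def)

lemma join_cols_mult:
  "join_cols P P' *v w = P *v (\<chi> i. w $ Inl i) + P' *v (\<chi> j. w $ Inr j)"
  by (simp add: vec_eq_iff matrix_vector_mult_def sum_UNIV_Plus join_cols_def)

text \<open>The mixed product rule for Kronecker products, with the identity as second
  factor.\<close>

lemma row_kron_mult_kron_vec:
  fixes v z :: "real^'a" and y :: "real^'b"
  shows "row_kron v (mat 1) *v kron_vec z y = (v \<bullet> z) *\<^sub>R y"
proof -
  have "(\<Sum>p\<in>UNIV. v $ fst p * (mat 1 :: real^'b^'b) $ r $ snd p * (z $ fst p * y $ snd p)) = (v \<bullet> z) * y $ r"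
    for r
  proof -
    have "(\<Sum>p\<in>UNIV. v $ fst p * (mat 1 :: real^'b^'b) $ r $ snd p * (z $ fst p * y $ snd p))
        = (\<Sum>i\<in>UNIV. \<Sum>j\<in>UNIV. if r = j then v $ i * (z $ i * y $ j) else 0)"
      unfolding UNIV_Times_UNIV[symmetric] sum.cartesian_product[symmetric]
      by (subst sum.cartesian_product) (auto intro!: sum.cong simp: mat_def)
    also have "\<dots> = (v \<bullet> z) * y $ r"
      by (simp add: inner_vec_def sum_distrib_right mult.assoc)
    finally show ?thesis .
  qed
  then show ?thesis
    by (simp add: vec_eq_iff matrix_vector_mult_def row_kron_def kron_vec_def)
qed

definition top_part :: "real^('a::finite + 'b::finite) \<Rightarrow> real^'a" where
  "top_part z = (\<chi> i. z $ Inl i)"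

lemma linear_top_part: "linear top_part"
  by (rule linearI) (simp_all add: top_part_def vec_eq_iff)

lemma norm_top_part_le: "norm (top_part z) \<le> norm (z :: real^('a::finite + 'b::finite))"
  unfolding norm_eq_sqrt_inner
  by (rule real_sqrt_le_mono) (simp add: inner_vec_def sum_UNIV_Plus top_part_def sum_nonneg)

lemma row_kron_add: "row_kron (v + v') P = row_kron v P + row_kron v' P"
  by (simp add: row_kron_def vec_eq_iff algebra_simps)

lemma row_kron_scaleR: "row_kron (c *\<^sub>R v) P = c *\<^sub>R row_kron v P"
  by (simp add: row_kron_def vec_eq_iff algebra_simps)

lemma bounded_linear_join_vec_left: "bounded_linear (\<lambda>v::real^'a. join_vec v (0 :: real^'b))"
  unfolding linear_conv_bounded_linear[symmetric]
  by (rule linearI) (auto simp: vec_eq_iff join_vec_def split: sum.splits)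

lemma jacobian_mult:
  fixes f :: "real^'a \<Rightarrow> real^'b"
  assumes "(f has_derivative D) (at x)"
  shows "jacobian f (at x) *v v = D v"
  unfolding jacobian_def frechet_derivative_at[OF assms, symmetric]
  by (rule fun_cong[OF matrix_vector_mul(2)[OF has_derivative_linear[OF assms]]])

context tube_mpc
begin

text \<open>For a fixed disturbance the predictor is jointly linear in the lifted state and the
  input, up to a term bilinear in the two. With this split its derivative follows from the chain
  rule and the product rule.\<close>

definition fw_lin where
  "fw_lin w z u = top_part (matA S *v z + cols (vecb S) *v u)
     + join_cols (err_x S *\<^sub>R row_kron z (mat 1)) (err_u S *\<^sub>R row_kron u (mat 1)) *v w"

definition fw_bil where
  "fw_bil u z = top_part (\<Sum>i\<in>UNIV. (matB S i - matA S) *v (u $ i *\<^sub>R z))"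

lemma fw_eq: "fw S x u w = fw_lin w (lift S x) u + fw_bil u (lift S x)"
  unfolding fw_def Fhat_def top_part_def[symmetric] model_def Emat_def fw_lin_def fw_bil_def
  by (simp add: linear_add[OF linear_top_part])

lemma fw_lin_add: "fw_lin w (z + z') (u + u') = fw_lin w z u + fw_lin w z' u'"
  by (simp add: fw_lin_def row_kron_add linear_add[OF linear_top_part] join_cols_mult
      matrix_vector_right_distrib matrix_vector_mult_add_rdistrib scaleR_add_right)

lemma fw_lin_scaleR: "fw_lin w (c *\<^sub>R z) (c *\<^sub>R u) = c *\<^sub>R fw_lin w z u"
  by (simp add: fw_lin_def row_kron_scaleR linear_add[OF linear_top_part] linear_scale[OF linear_top_part] join_cols_mult
      matrix_vector_mult_scaleR scaleR_matrix_vector_assoc[symmetric] scaleR_add_right mult.commute)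

lemma bounded_linear_fw_lin: "bounded_linear (\<lambda>p. fw_lin w (fst p) (snd p))"
  unfolding linear_conv_bounded_linear[symmetric]
  by (rule linearI) (simp_all add: fw_lin_add fw_lin_scaleR)

lemma bounded_bilinear_fw_bil: "bounded_bilinear fw_bil"
  unfolding bilinear_conv_bounded_bilinear[symmetric] bilinear_def
proof (intro conjI allI linearI)
  fix u u' :: "(real, 'nu) vec" and z z' :: "(real, 'nx + 'ne) vec" and c :: real
  show "fw_bil (u + u') z = fw_bil u z + fw_bil u' z" "fw_bil u (z + z') = fw_bil u z + fw_bil u z'"
    by (simp_all add: fw_bil_def matrix_vector_right_distrib scaleR_add_left scaleR_add_right
      sum.distrib linear_add[OF linear_top_part])
  show "fw_bil (c *\<^sub>R u) z = c *\<^sub>R fw_bil u z" "fw_bil u (c *\<^sub>R z) = c *\<^sub>R fw_bil u z"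
    unfolding fw_bil_def linear_scale[OF linear_top_part, symmetric] scaleR_sum_right
    by (simp_all add: matrix_vector_mult_scaleR mult.commute)
qed

definition Dobs where
  "Dobs = (SOME D. \<forall>l. (\<forall>x. (obs S l has_derivative blinfun_apply (D l x)) (at x)) \<and> continuous_on UNIV (D l))"

lemma Dobs: "(obs S l has_derivative blinfun_apply (Dobs l x)) (at x)"
  and Dobs_continuous: "continuous_on UNIV (Dobs l)"
proof -
  have "\<exists>D. \<forall>l. (\<forall>x. (obs S l has_derivative blinfun_apply (D l x)) (at x)) \<and> continuous_on UNIV (D l)"
    using learned unfolding learned_assms_def continuously_differentiable_def by metis
  from someI_ex[OF this, folded Dobs_def]
  show "(obs S l has_derivative blinfun_apply (Dobs l x)) (at x)" "continuous_on UNIV (Dobs l)" by blast+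
qed

definition Dlift where
  "Dlift x v = join_vec v 0 + (\<Sum>l\<in>UNIV. Dobs l x v *\<^sub>R join_vec 0 (axis l 1))"

text \<open>As a linear part plus a finite sum of scalar functions times constant vectors, the lift
  can be differentiated by the standard rules.\<close>

lemma lift_expand: "lift S x = join_vec x 0 + (\<Sum>l\<in>UNIV. obs S l x *\<^sub>R join_vec 0 (axis l 1))"
proof -
  have "lift S x $ p = (join_vec x 0 + (\<Sum>l\<in>UNIV. obs S l x *\<^sub>R join_vec 0 (axis l 1))) $ p" for p
    by (cases p) (simp_all add: lift_def axis_def if_distrib[of "\<lambda>a. _ * a"] cong: if_cong)
  then show ?thesis by (simp add: vec_eq_iff)
qed

lemma lift_deriv: "(lift S has_derivative Dlift x) (at x)"
proof -
  have "((\<lambda>x. join_vec x 0 + (\<Sum>l\<in>UNIV. obs S l x *\<^sub>R join_vec 0 (axis l 1))) has_derivative Dlift x) (at x)"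
    unfolding Dlift_def[abs_def]
    by (intro has_derivative_add has_derivative_sum has_derivative_scaleR_left Dobs
        bounded_linear_imp_has_derivative[OF bounded_linear_join_vec_left])
  then show ?thesis by (simp flip: lift_expand add: fun_eq_iff)
qed

lemma lift_continuous: "continuous_on UNIV (lift S)"
  using lift_deriv by (rule has_derivative_continuous_on)

lemma Dlift_continuous:
  assumes "continuous_on T a" "continuous_on T v"
  shows "continuous_on T (\<lambda>s. Dlift (a s) (v s))"
  unfolding Dlift_def
  by (intro continuous_intros bounded_linear.continuous_on[OF bounded_linear_join_vec_left] assms
      continuous_on_compose2[OF Dobs_continuous]) auto

lemma lift_zero: "lift S 0 = 0"
  using learned by (simp add: lift_def learned_assms_def vec_eq_iff join_vec_def split: sum.splits)

definition Dfw where
  "Dfw x u w dx du = fw_lin w (Dlift x dx) du + (fw_bil u (Dlift x dx) + fw_bil du (lift S x))"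

text \<open>The state and the input are functions of an arbitrary parameter, so one statement covers
  both partial derivatives in \<open>Acl\<close> and the derivative along a tube curve.\<close>

lemma fw_deriv:
  assumes "(a has_derivative a') (at s within T)" "(b has_derivative b') (at s within T)"
  shows "((\<lambda>s. fw S (a s) (b s) w) has_derivative (\<lambda>h. Dfw (a s) (b s) w (a' h) (b' h))) (at s within T)"
proof -
  have l: "((\<lambda>s. lift S (a s)) has_derivative (\<lambda>h. Dlift (a s) (a' h))) (at s within T)"
    using has_derivative_compose[OF assms(1) lift_deriv] .
  show ?thesis
    unfolding fw_eq Dfw_def
    using has_derivative_add[OF
        bounded_linear.has_derivative[OF bounded_linear_fw_lin has_derivative_Pair[OF l assms(2)]]
        bounded_bilinear.FDERIV[OF bounded_bilinear_fw_bil assms(2) l]] by simp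
qed

text \<open>The two Jacobians add up to the total derivative in the direction in which the input
  follows the gain. Hence \<open>Acl\<close> maps the velocity of a tube curve to the velocity of
  its image.\<close>

lemma Acl_mult: "Acl S x u w *v v = Dfw x u w v (K x *v v)"
proof -
  have "Dlift x 0 = 0"
    using has_derivative_linear[OF lift_deriv] by (rule linear_0)
  then have D: "Dfw x u w dx 0 + Dfw x u w 0 du = Dfw x u w dx du" for dx du
    using fw_lin_add[of w "Dlift x dx" 0 0 du]
    by (simp add: Dfw_def bounded_bilinear.zero_left[OF bounded_bilinear_fw_bil]
        bounded_bilinear.zero_right[OF bounded_bilinear_fw_bil])
  have "jacobian (\<lambda>x'. fw S x' u w) (at x) *v v = Dfw x u w v 0"
    by (rule jacobian_mult) (rule fw_deriv[OF has_derivative_ident has_derivative_const])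
  moreover have "jacobian (\<lambda>u'. fw S x u' w) (at u) *v (K x *v v) = Dfw x u w 0 (K x *v v)"
    by (rule jacobian_mult) (rule fw_deriv[OF has_derivative_const has_derivative_ident])
  ultimately show ?thesis
    by (simp add: Acl_def matrix_vector_mult_add_rdistrib D flip: matrix_vector_mul_assoc)
qed

section \<open>Riemannian distance and contraction\<close>

lemma Vdist_le:
  assumes "\<gamma> \<in> C1_curves xb x"
  shows "Vdist S x xb \<le> curve_length M \<gamma>"
  unfolding Vdist_def
  by (rule cINF_lower[OF _ assms])
    (auto intro!: bdd_belowI[where m = 0] curve_length_nonneg metric_continuous metric_pos_def)

lemma geodesic_C1: "geodesic S xb x \<in> C1_curves xb x"
  using geodesics by (simp add: geodesic_selection_def)

lemma Vdist_eq: "Vdist S x xb = curve_length M (geodesic S xb x)"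
proof (rule antisym)
  show "curve_length M (geodesic S xb x) \<le> Vdist S x xb"
    unfolding Vdist_def
  proof (rule cINF_greatest)
    show "C1_curves xb x \<noteq> {}" using geodesic_C1 by blast
  qed (use geodesics in \<open>auto simp: geodesic_selection_def\<close>)
qed (rule Vdist_le[OF geodesic_C1])

lemma Vdist_nonneg: "0 \<le> Vdist S x xb"
  unfolding Vdist_eq by (rule curve_length_nonneg[OF geodesic_C1 metric_continuous metric_pos_def])

lemma Vdist_triangle: "Vdist S x z \<le> Vdist S x y + Vdist S y z"
proof -
  obtain \<gamma> where "\<gamma> \<in> C1_curves z x"
      "curve_length M \<gamma> = curve_length M (geodesic S z y) + curve_length M (geodesic S y x)"
    using C1_curves_concat[OF geodesic_C1 geodesic_C1 metric_continuous] by metis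
  then show ?thesis using Vdist_le[of \<gamma> z x] by (simp add: Vdist_eq[of x y] Vdist_eq[of y z])
qed

text \<open>The metric bounds of RCCM refer to the constraint set and its predicted successors,
  which a segment may leave. On a ball, compactness supplies the constant and convexity keeps the
  segment inside.\<close>

lemma Vdist_ball_le: "\<exists>\<beta>>0. \<forall>x\<in>cball 0 r. \<forall>y\<in>cball 0 r. Vdist S x y \<le> \<beta> * norm (x - y)"
proof -
  obtain C where C: "0 < C" "\<And>(A::((real, 'nx) vec, 'nx) vec) v. norm (A *v v) \<le> norm A * norm v * C"
    using bounded_bilinear.pos_bounded[OF bounded_bilinear_matrix_vector_mult] by blast
  have "bounded (M ` cball 0 r)"
    by (intro compact_imp_bounded compact_continuous_image continuous_on_subset[OF metric_continuous]) auto
  then obtain B where B: "0 < B" "\<And>x. x \<in> cball 0 r \<Longrightarrow> norm (M x) \<le> B"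
    unfolding bounded_pos by blast
  have w: "wnorm (M x) v \<le> sqrt (B * C) * norm v" if "x \<in> cball 0 r" for x v
  proof -
    have "v \<bullet> (M x *v v) \<le> norm v * norm (M x *v v)" by (rule norm_cauchy_schwarz)
    also have "\<dots> \<le> norm v * (norm (M x) * norm v * C)"
      by (intro mult_left_mono C) auto
    also have "\<dots> \<le> norm v * (B * norm v * C)"
      using C(1) B(2)[OF that] by (intro mult_left_mono mult_right_mono) auto
    finally have "v \<bullet> (M x *v v) \<le> B * C * (norm v)\<^sup>2"
      by (simp add: power2_eq_square mult_ac)
    then show ?thesis by (rule wnorm_le_sqrt)
  qed
  have "Vdist S x y \<le> sqrt (B * C) * norm (x - y)" if "x \<in> cball 0 r" "y \<in> cball 0 r" for x y
  proof -
    have "y + s *\<^sub>R (x - y) \<in> cball 0 r" if "s \<in> {0..1}" for s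
    proof -
      have "(1 - s) *\<^sub>R y + s *\<^sub>R x \<in> cball 0 r"
        using that \<open>x \<in> cball 0 r\<close> \<open>y \<in> cball 0 r\<close> by (intro convexD[OF convex_cball]) auto
      then show ?thesis by (simp add: algebra_simps)
    qed
    then show ?thesis
      by (intro order_trans[OF Vdist_le[OF segment_C1_curve] segment_length_le[OF metric_continuous]] w)
  qed
  then show ?thesis using B(1) C(1) by (intro exI[of _ "sqrt (B * C)"]) auto
qed

text \<open>\<open>tube_before_end\<close> covers the times at which less than the full length has
  been used. The first time at which all of it is used is a limit of such times, and after it the
  curve and its input stand still.\<close>

lemma tube_in_Z:
  assumes \<gamma>: "\<gamma> \<in> C1_curves xb x" and t: "t \<in> {0..1}"
    and feas: "\<And>j. hcon S j xb ub + tightening S j * curve_length M \<gamma> \<le> 0"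
  shows "(\<gamma> t, ub + integral {0..t} (\<lambda>s. K (\<gamma> s) *v velocity \<gamma> s)) \<in> Z"
proof -
  note cv = C1_curvesD(2)[OF \<gamma>] and c\<gamma> = C1_curvesD(3)[OF \<gamma>]
  define \<delta> where "\<delta> = curve_length M \<gamma>"
  define f where "f = (\<lambda>s. wnorm (M (\<gamma> s)) (velocity \<gamma> s))"
  define k where "k = (\<lambda>s. K (\<gamma> s) *v velocity \<gamma> s)"
  define L where "L = (\<lambda>s. integral {0..s} f)"
  define \<upsilon> where "\<upsilon> = (\<lambda>s. ub + integral {0..s} k)"
  have \<delta>0: "0 \<le> \<delta>" unfolding \<delta>_def
    by (rule curve_length_nonneg[OF \<gamma> metric_continuous metric_pos_def])
  have f0: "0 \<le> f s" for s by (simp add: f_def wnorm_nonneg metric_pos_def)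
  have cf: "continuous_on {0..1} f" and ck: "continuous_on {0..1} k"
    unfolding f_def k_def
    by (intro continuous_intros continuous_on_compose2[OF metric_continuous c\<gamma>]
        continuous_on_compose2[OF gain_continuous c\<gamma>] cv subset_UNIV)+
  have cL: "continuous_on {0..1} L" and c\<upsilon>: "continuous_on {0..1} \<upsilon>"
    unfolding L_def \<upsilon>_def
    by (intro continuous_intros indefinite_integral_continuous_1 integrable_continuous_real cf ck)+
  have below: "(\<gamma> s, \<upsilon> s) \<in> Z" if "s \<in> {0..1}" "L s < \<delta>" for s
    using tube_before_end[OF \<gamma> that(1) feas that(2)[unfolded L_def f_def \<delta>_def] \<delta>0[unfolded \<delta>_def]]
    by (simp add: \<upsilon>_def k_def)
  have comb: "integral {0..b} g = integral {0..a} g + integral {a..b} g"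
    if "continuous_on {0..1} g" "0 \<le> a" "a \<le> b" "b \<le> 1" for a b and g :: "real \<Rightarrow> 'b::euclidean_space"
    using that by (intro Henstock_Kurzweil_Integration.integral_combine[symmetric] integrable_continuous_real
        continuous_on_subset[OF that(1)]) auto
  have tail0: "0 \<le> integral {a..b} f" if "0 \<le> a" "b \<le> 1" for a b
    by (rule integral_nonneg) (use that f0 in \<open>auto intro!: integrable_continuous_real continuous_on_subset[OF cf]\<close>)
  have L1: "L 1 = \<delta>" by (simp add: L_def \<delta>_def f_def curve_length_def)
  have "(\<gamma> t, \<upsilon> t) \<in> Z"
  proof (cases "L t < \<delta>")
    case True
    then show ?thesis using below t by blast
  next
    case False
    \<comment> \<open>Its least element \<open>r\<close> is the time at which the full length is
      first reached.\<close>
    define R where "R = {s \<in> {0..t}. \<delta> \<le> L s}"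
    have "closed R" unfolding R_def
      by (rule continuous_on_closed_Collect_le) (use t in \<open>auto intro: continuous_on_subset[OF cL]\<close>)
    moreover have "bounded R" by (rule bounded_subset[of "{0..t}"]) (auto simp: R_def)
    ultimately have "compact R" using compact_eq_bounded_closed by blast
    moreover have "t \<in> R" using t False by (auto simp: R_def)
    ultimately obtain r where r: "r \<in> R" "\<And>s. s \<in> R \<Longrightarrow> r \<le> s"
      using compact_attains_inf[of R] by blast
    then have r0: "0 \<le> r" "r \<le> t" "r \<in> {0..1}" and Lr: "\<delta> \<le> L r" using t by (auto simp: R_def)
    have before: "(\<gamma> s, \<upsilon> s) \<in> Z" if "0 \<le> s" "s < r" for s
      using below[of s] that r(2)[of s] r0 by (force simp: R_def)
    have inZ: "(\<gamma> r, \<upsilon> r) \<in> Z"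
    \<comment> \<open>\<open>r = 0\<close> means that the whole curve has length zero, so there is
      no earlier time to take a limit from; the nominal point itself is feasible.\<close>
    proof (cases "r = 0")
      case True
      have "hcon S j xb ub \<le> 0" for j
        using feas[of j] mult_nonneg_nonneg[OF tightening_nonneg \<delta>0, of j] by (simp add: \<delta>_def)
      then show ?thesis using C1_curvesD(4)[OF \<gamma>] by (simp add: True Z_iff \<upsilon>_def)
    next
      case False
      define P where "P = {s \<in> {0..1}. (\<gamma> s, \<upsilon> s) \<in> Z}"
      have "closed P"
        using continuous_closed_preimage[OF continuous_on_Pair[OF c\<gamma> c\<upsilon>] _ compact_imp_closed[OF Z_compact]]
        by (simp add: P_def vimage_def Int_def)
      moreover have "{0..<r} \<subseteq> P" using before r0 by (auto simp: P_def)
      ultimately have "closure {0..<r} \<subseteq> P" by (rule closure_minimal[rotated])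
      moreover have "r \<in> closure {0..<r}" using False r0 by simp
      ultimately show ?thesis by (auto simp: P_def)
    qed
    show ?thesis
    proof (cases "r = t")
      case False
      \<comment> \<open>No length is left after \<open>r\<close>. The integrand is continuous and
        nonnegative, so it vanishes, and definiteness of the metric makes the velocity
        vanish.\<close>
      have "integral {r..t} f = 0"
        using comb[OF cf, of r t] comb[OF cf, of t 1] tail0[of r t] tail0[of t 1] r0 t L1 Lr
        by (simp add: L_def)
      moreover have "continuous_on {r..t} f" using r0 t by (auto intro: continuous_on_subset[OF cf])
      ultimately have "f s = 0" if "s \<in> {r..t}" for s
        using integral_eq_0_iff[of r t f] f0 False r0 that by auto
      then have vel0: "velocity \<gamma> s = 0" if "s \<in> {r..t}" for s
        using that wnorm_eq_0[OF metric_pos_def] by (simp add: f_def)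
      have "(velocity \<gamma> has_integral \<gamma> t - \<gamma> r) {r..t}"
      proof (rule fundamental_theorem_of_calculus)
        show "(\<gamma> has_vector_derivative velocity \<gamma> s) (at s within {r..t})" if "s \<in> {r..t}" for s
          by (rule has_vector_derivative_within_subset[OF C1_curvesD(1)[OF \<gamma>]]) (use that r0 t in auto)
      qed (use r0 in simp)
      moreover have "(velocity \<gamma> has_integral 0) {r..t}"
        by (rule has_integral_is_0) (rule vel0)
      ultimately have "\<gamma> t - \<gamma> r = 0" by (rule has_integral_unique)
      then have "\<gamma> t = \<gamma> r" by simp
      moreover have "(k has_integral 0) {r..t}"
        by (rule has_integral_is_0) (simp add: vel0 k_def)
      then have "\<upsilon> t = \<upsilon> r" using comb[OF ck, of r t] r0 t by (simp add: \<upsilon>_def integral_unique)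
      ultimately show ?thesis using inZ by simp
    qed (use inZ in simp)
  qed
  then show ?thesis by (simp add: \<upsilon>_def k_def)
qed

lemma contraction_step:
  assumes "(x, u) \<in> Z" "w \<in> Dset"
  shows "wnorm (M (fw S x u w)) (Acl S x u w *v v) \<le> sqrt (1 - rho_c S) * wnorm (M x) v"
proof -
  have "(Acl S x u w *v v) \<bullet> (M (fw S x u w) *v (Acl S x u w *v v)) \<le> (1 - rho_c S) * (v \<bullet> (M x *v v))"
  proof -
    let ?A = "Acl S x u w" and ?N = "M (fw S x u w)"
    have "v \<bullet> ((transpose ?A ** ?N ** ?A) *v v) = v \<bullet> ((?N *v (?A *v v)) v* ?A)"
      by (simp add: matrix_vector_mul_assoc[symmetric])
    also have "\<dots> = (?A *v v) \<bullet> (?N *v (?A *v v))"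
      by (metis dot_lmul_matrix inner_commute)
    finally show ?thesis
      using loewner_leD[OF rccm_D(1)[OF assms], of v]
      by (simp add: scaleR_matrix_vector_assoc[symmetric])
  qed
  then show ?thesis
    unfolding wnorm_def by (metis real_sqrt_le_mono real_sqrt_mult)
qed

text \<open>The disturbance \<open>w\<close> is frozen along the whole curve, so the image has
  velocity \<open>Acl\<close> times that of the curve and the contraction inequality can be
  integrated pointwise. It is available at every point because the tube lies in
  \<open>Z\<close>.\<close>

lemma tube_image_length:
  assumes \<gamma>: "\<gamma> \<in> C1_curves xb x" and w: "w \<in> Dset"
    and feas: "\<And>j. hcon S j xb ub + tightening S j * curve_length M \<gamma> \<le> 0"
  defines "u \<equiv> ub + integral {0..1} (\<lambda>s. K (\<gamma> s) *v velocity \<gamma> s)"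
  shows "Vdist S (fw S x u w) (fw S xb ub w) \<le> sqrt (1 - rho_c S) * curve_length M \<gamma>"
proof -
  note cv = C1_curvesD(2)[OF \<gamma>] and c\<gamma> = C1_curvesD(3)[OF \<gamma>]
  define k where "k = (\<lambda>s. K (\<gamma> s) *v velocity \<gamma> s)"
  define \<upsilon> where "\<upsilon> = (\<lambda>s. ub + integral {0..s} k)"
  define \<eta> where "\<eta> = (\<lambda>s. fw S (\<gamma> s) (\<upsilon> s) w)"
  have ck: "continuous_on {0..1} k"
    unfolding k_def by (intro continuous_intros continuous_on_compose2[OF gain_continuous c\<gamma>] cv subset_UNIV)
  have d\<upsilon>: "(\<upsilon> has_vector_derivative k s) (at s within {0..1})" if "s \<in> {0..1}" for s
    using has_vector_derivative_add[OF has_vector_derivative_const integral_has_vector_derivative[OF ck that]]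
    by (simp add: \<upsilon>_def)
  have c\<upsilon>: "continuous_on {0..1} \<upsilon>"
    using d\<upsilon> has_vector_derivative_continuous unfolding continuous_on_eq_continuous_within by blast
  have d\<eta>: "(\<eta> has_vector_derivative Acl S (\<gamma> s) (\<upsilon> s) w *v velocity \<gamma> s) (at s within {0..1})"
    if "s \<in> {0..1}" for s
  proof -
    have "(\<eta> has_derivative (\<lambda>h. Dfw (\<gamma> s) (\<upsilon> s) w (h *\<^sub>R velocity \<gamma> s) (h *\<^sub>R k s))) (at s within {0..1})"
      unfolding \<eta>_def
      by (rule fw_deriv) (use C1_curvesD(1)[OF \<gamma> that] d\<upsilon>[OF that] in \<open>auto simp: has_vector_derivative_def\<close>)
    moreover have "Dfw (\<gamma> s) (\<upsilon> s) w (h *\<^sub>R velocity \<gamma> s) (h *\<^sub>R k s)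
        = h *\<^sub>R (Acl S (\<gamma> s) (\<upsilon> s) w *v velocity \<gamma> s)" for h
      using Acl_mult[of "\<gamma> s" "\<upsilon> s" w "h *\<^sub>R velocity \<gamma> s"]
      by (simp add: k_def matrix_vector_mult_scaleR)
    ultimately show ?thesis by (simp add: has_vector_derivative_def)
  qed
  have cd: "continuous_on {0..1} (\<lambda>s. Acl S (\<gamma> s) (\<upsilon> s) w *v velocity \<gamma> s)"
    unfolding Acl_mult Dfw_def
    by (intro continuous_on_add bounded_bilinear.continuous_on[OF bounded_bilinear_fw_bil] Dlift_continuous
        c\<gamma> cv c\<upsilon> continuous_on_compose2[OF lift_continuous c\<gamma>] subset_UNIV ck[unfolded k_def]
        bounded_linear.continuous_on[OF bounded_linear_fw_lin
          continuous_on_Pair[OF Dlift_continuous[OF c\<gamma> cv] ck], unfolded fst_conv snd_conv k_def])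
  have \<eta>: "\<eta> \<in> C1_curves (fw S xb ub w) (fw S x u w)"
    by (rule C1_curvesI[OF _ _ cd d\<eta>])
      (simp_all add: \<eta>_def \<upsilon>_def k_def u_def C1_curvesD(4,5)[OF \<gamma>])
  have "curve_length M \<eta> \<le> sqrt (1 - rho_c S) * curve_length M \<gamma>"
  proof (rule has_integral_le[OF has_integral_curve_length[OF \<eta> metric_continuous]
      has_integral_mult_right[OF has_integral_curve_length[OF \<gamma> metric_continuous]]])
    fix s :: real assume s: "s \<in> {0..1}"
    have "(\<gamma> s, \<upsilon> s) \<in> Z" using tube_in_Z[OF \<gamma> s feas] by (simp add: \<upsilon>_def k_def)
    then show "wnorm (M (\<eta> s)) (velocity \<eta> s) \<le> sqrt (1 - rho_c S) * wnorm (M (\<gamma> s)) (velocity \<gamma> s)"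
      unfolding velocity_eq[OF d\<eta>[OF s] s] unfolding \<eta>_def using w by (rule contraction_step)
  qed
  then show ?thesis using Vdist_le[OF \<eta>] by linarith
qed

end

section \<open>Recursive feasibility and cost decrease\<close>

lemma pos_def_ge_norm:
  fixes P :: "real^'n^'n"
  assumes "pos_def P"
  obtains q where "0 < q" "\<And>y. q * (norm y)\<^sup>2 \<le> (wnorm P y)\<^sup>2"
proof -
  have "continuous_on (sphere 0 1) (\<lambda>y. y \<bullet> (P *v y))"
    by (intro continuous_intros)
  moreover have "sphere (0::real^'n) 1 \<noteq> {}" by simp
  ultimately obtain e where e: "e \<in> sphere 0 1" "\<And>y. y \<in> sphere 0 1 \<Longrightarrow> e \<bullet> (P *v e) \<le> y \<bullet> (P *v y)"
    using continuous_attains_inf[OF compact_sphere] by meson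
  have "e \<noteq> 0" using e(1) by auto
  then have pos: "0 < e \<bullet> (P *v e)" using assms by (simp add: pos_def_def)
  have "(e \<bullet> (P *v e)) * (norm y)\<^sup>2 \<le> (wnorm P y)\<^sup>2" for y
  proof (cases "y = 0")
    case False
    have "e \<bullet> (P *v e) \<le> sgn y \<bullet> (P *v sgn y)"
      by (rule e(2)) (use False in \<open>simp add: norm_sgn\<close>)
    also have "\<dots> = (y \<bullet> (P *v y)) / (norm y)\<^sup>2"
      by (simp add: sgn_div_norm matrix_vector_mult_scaleR power2_eq_square field_simps)
    finally show ?thesis
      using False wnorm_sq[OF assms, of y] by (simp add: field_simps)
  qed simp
  then show thesis by (rule that[OF pos])
qed

text \<open>The origin of the terminal weight: l / \<rho> times the square is the infinite sum of
  the costs of a tube that shrinks by sqrt (1 - \<rho>) per step, and the last term on the left is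
  the tail beyond \<open>n\<close>.\<close>

lemma geometric_tail_sum:
  fixes l \<rho> v :: real
  assumes "0 < \<rho>" "\<rho> < 1"
  shows "(\<Sum>i<n. l * (sqrt (1 - \<rho>) ^ i * v)\<^sup>2) + l / \<rho> * (sqrt (1 - \<rho>) ^ n * v)\<^sup>2 = l / \<rho> * v\<^sup>2"
proof (induction n)
  case (Suc n)
  have "(sqrt (1 - \<rho>) ^ Suc n * v)\<^sup>2 = (1 - \<rho>) * (sqrt (1 - \<rho>) ^ n * v)\<^sup>2"
    using assms by (simp add: power_mult_distrib)
  then have "l * (sqrt (1 - \<rho>) ^ n * v)\<^sup>2 + l / \<rho> * (sqrt (1 - \<rho>) ^ Suc n * v)\<^sup>2
      = l / \<rho> * (sqrt (1 - \<rho>) ^ n * v)\<^sup>2"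
    using assms by (simp add: field_simps)
  then show ?case using Suc by simp
qed simp

context tube_mpc
begin

section \<open>The model error as a disturbance\<close>

definition err_bd :: "(real, 'nx) vec \<Rightarrow> (real, 'nu) vec \<Rightarrow> real" where
  "err_bd x u = err_x S * norm (lift S x) + err_u S * norm u"

lemma err_nonneg: "0 \<le> err_x S" "0 \<le> err_u S"
  using error_bound by (auto simp: peb_def)

lemma err_bd_nonneg: "0 \<le> err_bd x u"
  using err_nonneg by (simp add: err_bd_def)

lemma Emat_mult:
  "Emat S x u *v join_vec (kron_vec wz wx) (kron_vec wu wx)
     = (err_x S * (lift S x \<bullet> wz) + err_u S * (u \<bullet> wu)) *\<^sub>R wx"
  by (simp add: Emat_def join_cols_mult row_kron_mult_kron_vec scaleR_add_left
      flip: scaleR_matrix_vector_assoc)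

lemma norm_Emat_mult_le:
  assumes "w \<in> Dset"
  shows "norm (Emat S x u *v w) \<le> err_bd x u"
proof -
  obtain wz wu wx where w: "w = join_vec (kron_vec wz wx) (kron_vec wu wx)"
    and n: "norm wz \<le> 1" "norm wu \<le> 1" "norm wx \<le> 1"
    using assms by (auto simp: Dset_def)
  have in1: "\<bar>a \<bullet> b\<bar> \<le> norm a" if "norm b \<le> 1" for a b :: "'z::real_inner"
    using Cauchy_Schwarz_ineq2[of a b] mult_left_mono[OF that, of "norm a"] by simp
  have "\<bar>err_x S * (lift S x \<bullet> wz) + err_u S * (u \<bullet> wu)\<bar>
      \<le> err_x S * \<bar>lift S x \<bullet> wz\<bar> + err_u S * \<bar>u \<bullet> wu\<bar>"
    using err_nonneg by (intro order_trans[OF abs_triangle_ineq]) (simp add: abs_mult)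
  also have "\<dots> \<le> err_bd x u"
    unfolding err_bd_def by (intro add_mono mult_left_mono in1 n err_nonneg)
  finally have "\<bar>err_x S * (lift S x \<bullet> wz) + err_u S * (u \<bullet> wu)\<bar> * norm wx \<le> err_bd x u * 1"
    by (intro mult_mono n err_bd_nonneg) auto
  then show ?thesis by (simp add: w Emat_mult)
qed

text \<open>Star-shapedness about 0 makes every point between the nominal and the disturbed
  prediction a prediction for some disturbance, so RCCM bounds the metric there. Only the common
  factor is scaled, since scaling both factors would square \<open>s\<close>.\<close>

lemma Dset_scaleR:
  assumes "w \<in> Dset" "s \<in> {0..1}"
  shows "s *\<^sub>R w \<in> Dset"
proof -
  obtain wz wu wx where w: "w = join_vec (kron_vec wz wx) (kron_vec wu wx)"
    and n: "norm wz \<le> 1" "norm wu \<le> 1" "norm wx \<le> 1"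
    using assms by (auto simp: Dset_def)
  have "s *\<^sub>R w = join_vec (kron_vec wz (s *\<^sub>R wx)) (kron_vec wu (s *\<^sub>R wx))"
    by (simp add: w vec_eq_iff join_vec_def kron_vec_def split: sum.splits)
  moreover have "norm (s *\<^sub>R wx) \<le> 1"
    using n assms(2) by (simp add: mult_le_one)
  ultimately show ?thesis unfolding Dset_def using n by (fastforce simp: mem_cball_0)
qed

text \<open>Together with \<open>norm_Emat_mult_le\<close>: the disturbance set is mapped exactly
  onto the ball of radius \<open>err_bd x u\<close>. Aligning the first factors with the lifted
  state and the input attains the largest scalar, and the common factor carries the direction of
  \<open>d\<close>.\<close>

lemma Emat_mult_onto:
  assumes "norm d \<le> err_bd x u"
  shows "\<exists>w\<in>Dset. Emat S x u *v w = d"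
proof -
  have sg: "z \<bullet> sgn z = norm z" for z :: "'z::real_inner"
    by (cases "z = 0") (simp_all add: sgn_div_norm power2_eq_square flip: power2_norm_eq_inner)
  \<comment> \<open>If \<open>err_bd x u\<close> is 0, then \<open>d\<close> is 0 and division by
    zero yields \<open>wx = 0\<close>, which is the right witness.\<close>
  define wx where "wx = (1 / err_bd x u) *\<^sub>R d"
  let ?w = "join_vec (kron_vec (sgn (lift S x)) wx) (kron_vec (sgn u) wx)"
  have "norm wx \<le> 1"
    using assms err_bd_nonneg[of x u] by (cases "err_bd x u = 0") (auto simp: wx_def)
  then have "?w \<in> Dset"
    unfolding Dset_def by (force simp: norm_sgn)
  moreover have "Emat S x u *v ?w = err_bd x u *\<^sub>R wx"
    by (simp add: Emat_mult sg err_bd_def)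
  moreover have "err_bd x u *\<^sub>R wx = d"
    using assms by (cases "err_bd x u = 0") (auto simp: wx_def)
  ultimately show ?thesis by auto
qed

lemma Fmap_eq_fw:
  assumes "(x, u) \<in> Z"
  shows "\<exists>w\<in>Dset. Fmap S x u = fw S x u w"
proof -
  \<comment> \<open>The lift contains the state itself, so the top block of the lifted residual is
    the prediction error of the state.\<close>
  have "Fmap S x u - Fhat S x u = top_part (lift S (Fmap S x u) - model S x u)"
    by (simp add: vec_eq_iff top_part_def lift_def Fhat_def)
  then have "norm (Fmap S x u - Fhat S x u) \<le> norm (lift S (Fmap S x u) - model S x u)"
    by (simp add: norm_top_part_le)
  also have "\<dots> \<le> err_bd x u"
    using error_bound Z_sub[OF assms] by (simp add: peb_def err_bd_def)
  finally obtain w where "w \<in> Dset" "Emat S x u *v w = Fmap S x u - Fhat S x u"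
    using Emat_mult_onto by blast
  then show ?thesis by (intro bexI[of _ w]) (auto simp: fw_def)
qed

lemma closed_loop_step:
  assumes feas: "\<And>j. hcon S j xb ub + tightening S j * Vdist S x xb \<le> 0"
  defines "u \<equiv> kappa S x xb ub"
  shows "(x, u) \<in> Z"
    and "Vdist S (Fmap S x u) (Fhat S xb ub) \<le> delta_next S xb ub (Vdist S x xb)"
    and "sqrt (alpha1 S) * norm (x - xb) \<le> Vdist S x xb"
proof -
  let ?g = "geodesic S xb x"
  note \<gamma> = geodesic_C1[of xb x]
  note feas' = feas[unfolded Vdist_eq]
  have u: "u = ub + integral {0..1} (\<lambda>s. K (?g s) *v velocity ?g s)"
    by (simp add: u_def kappa_def input_curve_def)
  show xuZ: "(x, u) \<in> Z"
    using tube_in_Z[OF \<gamma> _ feas', of 1] C1_curvesD(5)[OF \<gamma>] by (simp add: u)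
  have "(xb, ub) \<in> Z"
    using tube_in_Z[OF \<gamma> _ feas', of 0] C1_curvesD(4)[OF \<gamma>] by simp
  obtain w where w: "w \<in> Dset" "Fmap S x u = fw S x u w"
    using Fmap_eq_fw[OF xuZ] by blast
  have 1: "Vdist S (Fmap S x u) (fw S xb ub w) \<le> sqrt (1 - rho_c S) * Vdist S x xb"
    unfolding w(2) Vdist_eq[of x xb] unfolding u by (rule tube_image_length[OF \<gamma> w(1) feas'])
  have "Vdist S (fw S xb ub w) (Fhat S xb ub) \<le> sqrt (alpha2 S) * err_bd xb ub"
  \<comment> \<open>The straight segment is an admissible competitor for the distance, and the upper
    metric bound holds at each of its points.\<close>
  proof (rule order_trans[OF Vdist_le[OF segment_C1_curve] segment_length_le[OF metric_continuous]])
    fix s :: real assume s: "s \<in> {0..1}"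
    have d: "fw S xb ub w - Fhat S xb ub = Emat S xb ub *v w"
      by (simp add: fw_def)
    have "Fhat S xb ub + s *\<^sub>R (Emat S xb ub *v w) = fw S xb ub (s *\<^sub>R w)"
      by (simp add: fw_def matrix_vector_mult_scaleR)
    then have "wnorm (M (Fhat S xb ub + s *\<^sub>R (Emat S xb ub *v w))) (Emat S xb ub *v w)
        \<le> sqrt (alpha2 S) * norm (Emat S xb ub *v w)"
      using wnorm_le_upper[OF rccm_D(2)[OF \<open>(xb, ub) \<in> Z\<close> Dset_scaleR[OF w(1) s]]] by simp
    also have "\<dots> \<le> sqrt (alpha2 S) * err_bd xb ub"
      using alpha(2) by (intro mult_left_mono norm_Emat_mult_le w) auto
    finally show "wnorm (M (Fhat S xb ub + s *\<^sub>R (fw S xb ub w - Fhat S xb ub))) (fw S xb ub w - Fhat S xb ub)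
        \<le> sqrt (alpha2 S) * err_bd xb ub"
      by (simp only: d)
  qed
  then show "Vdist S (Fmap S x u) (Fhat S xb ub) \<le> delta_next S xb ub (Vdist S x xb)"
    using 1 Vdist_triangle[of "Fmap S x u" "Fhat S xb ub" "fw S xb ub w"]
    by (simp add: delta_next_def err_bd_def)
  \<comment> \<open>The lower metric bound holds all along the geodesic because the tube lies in
    \<open>Z\<close>; hence its length dominates the chord.\<close>
  have vint: "(velocity ?g has_integral x - xb) {0..1}"
    using fundamental_theorem_of_calculus[of 0 1 ?g "velocity ?g"] C1_curvesD(1,4,5)[OF \<gamma>] by auto
  have "norm (integral {0..1} (\<lambda>s. sqrt (alpha1 S) *\<^sub>R velocity ?g s))
      \<le> integral {0..1} (\<lambda>s. wnorm (M (?g s)) (velocity ?g s))"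
  proof (rule integral_norm_bound_integral)
    show "(\<lambda>s. sqrt (alpha1 S) *\<^sub>R velocity ?g s) integrable_on {0..1}"
      using vint by (auto intro!: integrable_cmul)
    show "(\<lambda>s. wnorm (M (?g s)) (velocity ?g s)) integrable_on {0..1}"
      using has_integral_curve_length[OF \<gamma> metric_continuous] by blast
    fix s :: real assume "s \<in> {0..1}"
    then show "norm (sqrt (alpha1 S) *\<^sub>R velocity ?g s) \<le> wnorm (M (?g s)) (velocity ?g s)"
      using wnorm_ge_lower[OF Z_metric_bounds(1)[OF tube_in_Z[OF \<gamma> _ feas']]] alpha(1) by simp
  qed
  then show "sqrt (alpha1 S) * norm (x - xb) \<le> Vdist S x xb"
    using vint alpha(1) by (simp add: Vdist_eq curve_length_def integral_unique)
qed

section \<open>Feasible plans and their costs\<close>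

abbreviation "N \<equiv> horizon S"

lemma weights: "pos_def (weightQ S)" "pos_def (weightR S)" "0 < weightD S" "1 \<le> N"
  using mpc by (auto simp: mpc_assms_def)

lemma stage_cost_mono: "0 \<le> \<delta> \<Longrightarrow> \<delta> \<le> \<delta>' \<Longrightarrow> stage_cost S x u \<delta> \<le> stage_cost S x u \<delta>'"
  using weights(3) by (simp add: stage_cost_def power_mono)

lemma stage_cost_nonneg: "0 \<le> stage_cost S x u \<delta>"
  using weights(3) by (simp add: stage_cost_def)

lemma plan_cost_eq:
  "plan_cost S p = (\<Sum>i<N. stage_cost S (xbar p i) (ubar p i) (delta p i))
     + weightD S / rho_c S * (delta p N)\<^sup>2"
  by (simp add: plan_cost_def term_cost_eq)

lemma feasibleD:
  assumes "feasible S x p"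
  shows "i < N \<Longrightarrow> xbar p (Suc i) = Fhat S (xbar p i) (ubar p i)"
    and "i < N \<Longrightarrow> delta p (Suc i) = delta_next S (xbar p i) (ubar p i) (delta p i)"
    and "i < N \<Longrightarrow> hcon S j (xbar p i) (ubar p i) + tightening S j * delta p i \<le> 0"
    and "delta p 0 = Vdist S x (xbar p 0)"
    and "xbar p N = 0" "0 \<le> delta p N" "hcon S j 0 0 + tightening S j * delta p N \<le> 0"
  using assms by (auto simp: feasible_def term_set_eq term_ctrl_eq)

lemma delta_next_nonneg: "0 \<le> \<delta> \<Longrightarrow> 0 \<le> delta_next S x u \<delta>"
  using rho alpha err_bd_nonneg[of x u] by (simp add: delta_next_def err_bd_def)

lemma delta_next_mono: "\<delta> \<le> \<delta>' \<Longrightarrow> delta_next S x u \<delta> \<le> delta_next S x u \<delta>'"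
  using rho by (simp add: delta_next_def mult_left_mono)

text \<open>Nonnegativity starts from \<open>delta p 0\<close>, which is a distance, and is passed
  on by the recursion.\<close>

lemma feasible_delta_nonneg: "feasible S x p \<Longrightarrow> i \<le> N \<Longrightarrow> 0 \<le> delta p i"
proof (induction i)
  case 0
  then show ?case using feasibleD(4) Vdist_nonneg by simp
next
  case (Suc i)
  then show ?case using feasibleD(2) delta_next_nonneg by simp
qed

lemma feasible_in_Z:
  assumes "feasible S x p" "i < N"
  shows "(xbar p i, ubar p i) \<in> Z"
proof -
  have "hcon S j (xbar p i) (ubar p i) \<le> 0" for j
    using feasibleD(3)[OF assms, of j] assms
      mult_nonneg_nonneg[OF tightening_nonneg feasible_delta_nonneg[OF assms(1), of i], of j] by simp
  then show ?thesis by (simp add: Z_iff)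
qed

lemma feasible_step:
  assumes "feasible S x p"
  defines "u \<equiv> kappa S x (xbar p 0) (ubar p 0)"
  shows "(x, u) \<in> Z" "Vdist S (Fmap S x u) (xbar p 1) \<le> delta p 1"
    "sqrt (alpha1 S) * norm (x - xbar p 0) \<le> delta p 0"
proof -
  have N0: "0 < N" using weights(4) by simp
  have "hcon S j (xbar p 0) (ubar p 0) + tightening S j * Vdist S x (xbar p 0) \<le> 0" for j
    using feasibleD(3)[OF assms(1) N0, of j] feasibleD(4)[OF assms(1)] by simp
  note step = closed_loop_step[OF this]
  show "(x, u) \<in> Z" "Vdist S (Fmap S x u) (xbar p 1) \<le> delta p 1"
    "sqrt (alpha1 S) * norm (x - xbar p 0) \<le> delta p 0"
    using step feasibleD(1,2,4)[OF assms(1)] N0 by (simp_all add: u_def)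
qed

lemma Fhat_zero: "Fhat S 0 0 = 0"
  by (simp add: Fhat_def model_def lift_zero vec_eq_iff)

lemma delta_next_zero: "delta_next S 0 0 \<delta> = sqrt (1 - rho_c S) * \<delta>"
  by (simp add: delta_next_def lift_zero)

text \<open>The nominal states are the tail of the old plan, but the new tube size starts from the
  measured distance, at most the predicted \<open>delta p 1\<close>. Monotonicity of the recursion
  keeps it below the old one, which helps both the constraints and the cost.\<close>

lemma shifted_plan_feasible:
  assumes p: "feasible S x p" and x': "x' = Fmap S x (kappa S x (xbar p 0) (ubar p 0))"
  shows "feasible S x' (shifted_plan S x' p)"
    and "plan_cost S (shifted_plan S x' p)
      \<le> plan_cost S p - stage_cost S (xbar p 0) (ubar p 0) (delta p 0)"
proof -
  define q where "q = shifted_plan S x' p"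
  \<comment> \<open>Index \<open>m\<close> of the shifted plan corresponds to the old terminal
    state; there the appended zero input acts.\<close>
  obtain m where N: "N = Suc m" using weights(4) by (cases N) auto
  have u: "ubar q i = (if Suc i < N then ubar p (Suc i) else 0)" for i
    by (simp add: q_def shifted_plan_def Let_def term_ctrl_eq)
  have x0: "xbar q 0 = xbar p 1" and d0: "delta q 0 = Vdist S x' (xbar p 1)"
    by (simp_all add: q_def shifted_plan_def Let_def)
  have xS: "xbar q (Suc i) = Fhat S (xbar q i) (ubar q i)"
    and dS: "delta q (Suc i) = delta_next S (xbar q i) (ubar q i) (delta q i)" for i
    by (simp_all add: q_def shifted_plan_def Let_def case_prod_unfold)
  have rel: "xbar q i = xbar p (Suc i) \<and> 0 \<le> delta q i \<and> delta q i \<le> delta p (Suc i)" if "i \<le> m" for i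
    using that
  proof (induction i)
    case 0
    then show ?case using feasible_step(2)[OF p] Vdist_nonneg by (simp add: x0 d0 x')
  next
    case (Suc i)
    then show ?case
      using feasibleD(1,2)[OF p, of "Suc i"] delta_next_nonneg delta_next_mono N by (simp add: xS dS u)
  qed
  have xm: "xbar q m = 0" and um: "ubar q m = 0" using rel[of m] feasibleD(5)[OF p] by (simp_all add: N u)
  have xN: "xbar q N = 0" and dN: "delta q N = sqrt (1 - rho_c S) * delta q m"
    by (simp_all add: N xS dS xm um Fhat_zero delta_next_zero)
  have dm: "0 \<le> delta q m" "delta q m \<le> delta p N" using rel[of m] by (simp_all add: N)
  have dNm: "0 \<le> delta q N" "delta q N \<le> delta q m"
    using rho dm(1) by (auto simp: dN intro: mult_left_le_one_le)
  \<comment> \<open>The terminal constraint is the stage constraint at the origin, so it serves both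
    the appended stage and the new terminal point.\<close>
  have zero: "hcon S j 0 0 + tightening S j * \<delta> \<le> 0" if "\<delta> \<le> delta p N" for j \<delta>
    using feasibleD(7)[OF p, of j] mult_left_mono[OF that tightening_nonneg, of j] by linarith
  show "feasible S x' (shifted_plan S x' p)"
    unfolding q_def[symmetric] feasible_def
  proof (intro conjI allI impI)
    fix i j assume i: "i < N"
    show "xbar q (Suc i) = Fhat S (xbar q i) (ubar q i)" by (rule xS)
    show "delta q (Suc i) = delta_next S (xbar q i) (ubar q i) (delta q i)" by (rule dS)
    show "hcon S j (xbar q i) (ubar q i) + tightening S j * delta q i \<le> 0"
    proof (cases "i = m")
      case True
      then show ?thesis using zero[OF dm(2)] by (simp add: xm um)
    next
      case False
      then have "Suc i < N" "i \<le> m" using i N by auto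
      then show ?thesis
        using feasibleD(3)[OF p \<open>Suc i < N\<close>, of j] rel[OF \<open>i \<le> m\<close>]
          mult_left_mono[OF _ tightening_nonneg, of "delta q i" "delta p (Suc i)" j] by (simp add: u)
    qed
  next
    show "Vdist S x' (xbar q 0) = delta q 0" by (simp add: x0 d0)
    show "(xbar q N, delta q N) \<in> term_set S"
      using dNm zero[of "delta q N"] dm by (simp add: term_set_eq term_ctrl_eq xN)
  qed
  have "plan_cost S q = (\<Sum>i<m. stage_cost S (xbar q i) (ubar q i) (delta q i))
      + (weightD S * (delta q m)\<^sup>2 + weightD S / rho_c S * (delta q N)\<^sup>2)"
    using N by (simp add: plan_cost_eq stage_cost_def xm um wnorm_def)
  \<comment> \<open>The identity \<lambda> + (1 - \<rho>) \<lambda> / \<rho> = \<lambda> / \<rho>: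
    the appended stage and the new terminal cost together equal the terminal cost one step
    earlier.\<close>
  also have "weightD S * (delta q m)\<^sup>2 + weightD S / rho_c S * (delta q N)\<^sup>2 = weightD S / rho_c S * (delta q m)\<^sup>2"
    using rho by (simp add: dN power_mult_distrib field_simps)
  also have "(\<Sum>i<m. stage_cost S (xbar q i) (ubar q i) (delta q i)) + weightD S / rho_c S * (delta q m)\<^sup>2
      \<le> (\<Sum>i<m. stage_cost S (xbar p (Suc i)) (ubar p (Suc i)) (delta p (Suc i)))
        + weightD S / rho_c S * (delta p N)\<^sup>2"
  proof (intro add_mono sum_mono mult_left_mono power_mono dm)
    fix i assume "i \<in> {..<m}"
    then show "stage_cost S (xbar q i) (ubar q i) (delta q i)
        \<le> stage_cost S (xbar p (Suc i)) (ubar p (Suc i)) (delta p (Suc i))"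
      using rel[of i] stage_cost_mono by (simp add: u N)
  qed (use weights(3) rho in simp)
  also have "\<dots> = plan_cost S p - stage_cost S (xbar p 0) (ubar p 0) (delta p 0)"
    unfolding plan_cost_eq N by (simp add: sum.lessThan_Suc_shift del: sum.lessThan_Suc)
  finally show "plan_cost S (shifted_plan S x' p)
      \<le> plan_cost S p - stage_cost S (xbar p 0) (ubar p 0) (delta p 0)"
    by (simp add: q_def)
qed

lemma local_plan_feasible:
  assumes "\<And>j. hcon S j 0 0 + tightening S j * Vdist S x 0 \<le> 0"
  shows "feasible S x (local_plan S x)"
proof -
  define r where "r = sqrt (1 - rho_c S)"
  have r: "0 \<le> r" "r \<le> 1" using rho by (auto simp: r_def)
  have "hcon S j 0 0 + tightening S j * (r ^ i * Vdist S x 0) \<le> 0" for i j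
  proof -
    have "r ^ i * Vdist S x 0 \<le> Vdist S x 0"
      using r Vdist_nonneg by (simp add: mult_left_le_one_le power_le_one)
    from mult_left_mono[OF this tightening_nonneg, of j] assms[of j] show ?thesis by linarith
  qed
  then show ?thesis
    using r Vdist_nonneg
    by (simp add: feasible_def local_plan_def Fhat_zero delta_next_zero term_set_eq term_ctrl_eq r_def)
qed

lemma local_plan_cost: "plan_cost S (local_plan S x) = weightD S / rho_c S * (Vdist S x 0)\<^sup>2"
  using geometric_tail_sum[OF rho]
  by (simp add: plan_cost_eq local_plan_def stage_cost_def wnorm_def)

text \<open>The stage cost contains only the nominal state and the tube size. The first is
  controlled through \<open>weightQ\<close>, and the second dominates the distance of the true state
  from the nominal one.\<close>

lemma norm_le_stage_cost:
  obtains a where "0 < a"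
    "\<And>x p. feasible S x p \<Longrightarrow> a * (norm x)\<^sup>2 \<le> stage_cost S (xbar p 0) (ubar p 0) (delta p 0)"
proof -
  obtain q where q: "0 < q" "\<And>y. q * (norm y)\<^sup>2 \<le> (wnorm (weightQ S) y)\<^sup>2"
    using pos_def_ge_norm[OF weights(1)] by blast
  \<comment> \<open>The halves pay for the factor 2 in the bound of the square of a sum by twice the
    sum of squares.\<close>
  define a where "a = min (q / 2) (weightD S * alpha1 S / 2)"
  have a: "0 < a" "2 * a \<le> q" "2 * a \<le> weightD S * alpha1 S"
    using q weights(3) alpha by (auto simp: a_def)
  show thesis
  proof (rule that[OF a(1)])
    fix x and p :: "('nx, 'nu) plan" assume p: "feasible S x p"
    let ?y = "xbar p 0" and ?\<delta> = "delta p 0"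
    have "(sqrt (alpha1 S) * norm (x - ?y))\<^sup>2 \<le> ?\<delta>\<^sup>2"
      using alpha(1) by (intro power_mono feasible_step(3)[OF p]) auto
    then have d: "alpha1 S * (norm (x - ?y))\<^sup>2 \<le> ?\<delta>\<^sup>2"
      using alpha(1) by (simp add: power_mult_distrib)
    have "norm x \<le> norm ?y + norm (x - ?y)" using norm_triangle_ineq[of ?y "x - ?y"] by simp
    then have "(norm x)\<^sup>2 \<le> (norm ?y + norm (x - ?y))\<^sup>2" by (rule power_mono) simp
    also have "\<dots> \<le> 2 * (norm ?y)\<^sup>2 + 2 * (norm (x - ?y))\<^sup>2"
      using zero_le_power2[of "norm ?y - norm (x - ?y)"] by (simp add: power2_eq_square algebra_simps)
    finally have "a * (norm x)\<^sup>2 \<le> a * (2 * (norm ?y)\<^sup>2 + 2 * (norm (x - ?y))\<^sup>2)"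
      using a(1) by (intro mult_left_mono) auto
    also have "\<dots> = (2 * a) * (norm ?y)\<^sup>2 + (2 * a) * (norm (x - ?y))\<^sup>2" by (simp add: algebra_simps)
    also have "\<dots> \<le> q * (norm ?y)\<^sup>2 + (weightD S * alpha1 S) * (norm (x - ?y))\<^sup>2"
      using a by (intro add_mono mult_right_mono) auto
    also have "\<dots> \<le> (wnorm (weightQ S) ?y)\<^sup>2 + weightD S * ?\<delta>\<^sup>2"
      using q(2) mult_left_mono[OF d, of "weightD S"] weights(3) by (intro add_mono) (auto simp: mult.assoc)
    also have "\<dots> \<le> stage_cost S ?y (ubar p 0) ?\<delta>" by (simp add: stage_cost_def)
    finally show "a * (norm x)\<^sup>2 \<le> stage_cost S ?y (ubar p 0) ?\<delta>" .
  qed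
qed

text \<open>All pairs of a feasible plan lie in the compact \<open>Z\<close>. The initial tube size
  is bounded as a distance between points of a ball, and each of the \<open>N\<close> steps adds at
  most the bound \<open>E\<close> of the error term on \<open>Z\<close>.\<close>

lemma feasible_cost_bounded: "\<exists>B. \<forall>x p. feasible S x p \<longrightarrow> plan_cost S p \<le> B"
proof -
  obtain r where r: "\<And>x u. (x, u) \<in> Z \<Longrightarrow> norm (x, u) \<le> r"
    using compact_imp_bounded[OF Z_compact] unfolding bounded_iff by auto
  have rx: "norm x \<le> r" if "(x, u) \<in> Z" for x u
    using r[OF that] norm_fst_le[of x u] by simp
  obtain \<beta> where \<beta>: "0 < \<beta>" "\<And>x y. x \<in> cball 0 r \<Longrightarrow> y \<in> cball 0 r \<Longrightarrow> Vdist S x y \<le> \<beta> * norm (x - y)"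
    using Vdist_ball_le[of r] by blast
  have bd: "\<exists>B. \<forall>p\<in>Z. f p \<le> B" if "continuous_on Z f" for f :: "_ \<Rightarrow> real"
  proof -
    have "bounded (f ` Z)" using compact_continuous_image[OF that Z_compact] by (rule compact_imp_bounded)
    then show ?thesis unfolding bounded_iff by (force simp: abs_le_iff)
  qed
  define g where "g = (\<lambda>p. sqrt (alpha2 S) * err_bd (fst p) (snd p))"
  define c where "c = (\<lambda>p. (wnorm (weightQ S) (fst p))\<^sup>2 + (wnorm (weightR S) (snd p))\<^sup>2)"
  have "continuous_on Z g"
    unfolding g_def err_bd_def
    by (intro continuous_intros continuous_on_compose2[OF lift_continuous]) auto
  then obtain E where E: "\<And>p. p \<in> Z \<Longrightarrow> g p \<le> E" using bd by blast
  have "continuous_on Z c" unfolding c_def by (intro continuous_intros)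
  then obtain C where C: "\<And>p. p \<in> Z \<Longrightarrow> c p \<le> C" using bd by blast
  have E0: "0 \<le> E"
    using E[OF Z_zero] err_bd_nonneg[of 0 0] alpha(2) by (simp add: g_def order_trans[rotated])
  define D where "D = \<beta> * (2 * r) + real N * E"
  have "plan_cost S p \<le> real N * (C + weightD S * D\<^sup>2) + weightD S / rho_c S * D\<^sup>2" if p: "feasible S x p" for x p
  proof -
    \<comment> \<open>Paired with the input that is actually applied, the true state also lies in
      \<open>Z\<close>.\<close>
    have x: "x \<in> cball 0 r" using rx[OF feasible_step(1)[OF p]] by simp
    have y: "xbar p 0 \<in> cball 0 r" using rx[OF feasible_in_Z[OF p]] weights(4) by simp
    have "norm (x - xbar p 0) \<le> 2 * r"
      using norm_triangle_ineq4[of x "xbar p 0"] x y by simp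
    then have d0: "delta p 0 \<le> \<beta> * (2 * r)"
      using \<beta>(2)[OF x y] \<beta>(1) feasibleD(4)[OF p] by (smt (verit) mult_left_mono)
    have di: "delta p i \<le> \<beta> * (2 * r) + real i * E" if "i \<le> N" for i
      using that
    proof (induction i)
      case (Suc i)
      have "sqrt (1 - rho_c S) * delta p i \<le> delta p i"
        using rho feasible_delta_nonneg[OF p] Suc.prems by (intro mult_left_le_one_le) auto
      moreover have "g (xbar p i, ubar p i) \<le> E"
        using E feasible_in_Z[OF p] Suc.prems by simp
      ultimately have "delta p (Suc i) \<le> delta p i + E"
        using feasibleD(2)[OF p, of i] Suc.prems by (simp add: delta_next_def g_def err_bd_def)
      then show ?case using Suc by (simp add: algebra_simps)
    qed (use d0 in simp)
    have dD: "(delta p i)\<^sup>2 \<le> D\<^sup>2" if "i \<le> N" for i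
    proof (rule power_mono[OF _ feasible_delta_nonneg[OF p that]])
      have "real i * E \<le> real N * E" using that E0 by (simp add: mult_right_mono)
      then show "delta p i \<le> D" using di[OF that] by (simp add: D_def)
    qed
    have "stage_cost S (xbar p i) (ubar p i) (delta p i) \<le> C + weightD S * D\<^sup>2" if "i < N" for i
      using C[OF feasible_in_Z[OF p that]] dD[of i] that weights(3)
      by (simp add: stage_cost_def c_def add_mono mult_left_mono)
    then have "(\<Sum>i<N. stage_cost S (xbar p i) (ubar p i) (delta p i)) \<le> real N * (C + weightD S * D\<^sup>2)"
      using sum_bounded_above[of "{..<N}" "\<lambda>i. stage_cost S (xbar p i) (ubar p i) (delta p i)"] by simp
    moreover have "weightD S / rho_c S * (delta p N)\<^sup>2 \<le> weightD S / rho_c S * D\<^sup>2"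
      using dD[of N] weights(3) rho(1) by (intro mult_left_mono) auto
    ultimately show ?thesis unfolding plan_cost_eq by linarith
  qed
  then show ?thesis by blast
qed

text \<open>Near the origin the cost is controlled by that of the local plan, away from it by its global
  bound.\<close>

lemma cost_le_norm:
  obtains b where "0 < b"
    "\<And>x p. feasible S x p \<Longrightarrow> (feasible S x (local_plan S x) \<Longrightarrow> plan_cost S p \<le> plan_cost S (local_plan S x))
      \<Longrightarrow> plan_cost S p \<le> b * (norm x)\<^sup>2"
proof -
  obtain B where B: "\<And>x p. feasible S x p \<Longrightarrow> plan_cost S p \<le> B"
    using feasible_cost_bounded by blast
  obtain \<beta> where \<beta>: "0 < \<beta>" "\<And>x y. x \<in> cball 0 1 \<Longrightarrow> y \<in> cball 0 1 \<Longrightarrow> Vdist S x y \<le> \<beta> * norm (x - y)"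
    using Vdist_ball_le[of 1] by blast
  have "\<forall>\<^sub>F e in at_right 0. hcon S j 0 0 + tightening S j * (\<beta> * e) < 0" for j
  proof (rule order_tendstoD(2))
    show "((\<lambda>e. hcon S j 0 0 + tightening S j * (\<beta> * e)) \<longlongrightarrow> hcon S j 0 0 + tightening S j * (\<beta> * 0)) (at_right 0)"
      by (intro tendsto_intros)
  qed (use hcon_zero in simp)
  then have "\<forall>\<^sub>F e in at_right 0. \<forall>j. hcon S j 0 0 + tightening S j * (\<beta> * e) < 0"
    by (rule eventually_all_finite)
  moreover have "\<forall>\<^sub>F e::real in at_right 0. 0 < e \<and> e < 1"
    by (intro eventually_conj eventually_at_right_less eventually_at_rightI[of 0 1]) auto
  ultimately have "\<forall>\<^sub>F e in at_right 0. (\<forall>j. hcon S j 0 0 + tightening S j * (\<beta> * e) < 0) \<and> 0 < e \<and> e < 1"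
    by (rule eventually_conj)
  \<comment> \<open>Within radius \<open>e\<close> the slack of the constraints at the origin
    absorbs the tube size \<beta> \<open>e\<close>; \<open>e < 1\<close> keeps the state in the ball
    on which \<beta> is valid.\<close>
  then obtain e where e: "\<And>j. hcon S j 0 0 + tightening S j * (\<beta> * e) < 0" "0 < e" "e < 1"
    using eventually_happens trivial_limit_at_right_real by blast
  define b where "b = max (weightD S / rho_c S * \<beta>\<^sup>2) (B / e\<^sup>2)"
  show thesis
  proof (rule that)
    show "0 < b" using weights(3) rho \<beta> by (simp add: b_def less_max_iff_disj)
    fix x and p :: "('nx, 'nu) plan"
    assume p: "feasible S x p"
      and loc: "feasible S x (local_plan S x) \<Longrightarrow> plan_cost S p \<le> plan_cost S (local_plan S x)"
    show "plan_cost S p \<le> b * (norm x)\<^sup>2"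
    proof (cases "norm x \<le> e")
      case True
      have V: "Vdist S x 0 \<le> \<beta> * norm x" using \<beta>(2)[of x 0] True e(3) by simp
      also have "\<dots> \<le> \<beta> * e" using True \<beta>(1) by simp
      finally have "tightening S j * Vdist S x 0 \<le> tightening S j * (\<beta> * e)" for j
        by (intro mult_left_mono tightening_nonneg)
      then have "feasible S x (local_plan S x)"
        using e(1) by (intro local_plan_feasible) (smt (verit))
      then have "plan_cost S p \<le> weightD S / rho_c S * (Vdist S x 0)\<^sup>2"
        using loc by (simp add: local_plan_cost)
      also have "\<dots> \<le> weightD S / rho_c S * (\<beta> * norm x)\<^sup>2"
        using V Vdist_nonneg weights(3) rho by (intro mult_left_mono power_mono) auto
      also have "\<dots> = (weightD S / rho_c S * \<beta>\<^sup>2) * (norm x)\<^sup>2" by (simp add: power_mult_distrib)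
      also have "\<dots> \<le> b * (norm x)\<^sup>2" by (intro mult_right_mono) (auto simp: b_def)
      finally show ?thesis .
    next
      case False
      have "0 \<le> plan_cost S p"
        unfolding plan_cost_eq using weights(3) rho
        by (intro add_nonneg_nonneg sum_nonneg stage_cost_nonneg) auto
      then have "0 \<le> B" using B[OF p] by linarith
      have "B = B / e\<^sup>2 * e\<^sup>2" using e(2) by simp
      also have "\<dots> \<le> B / e\<^sup>2 * (norm x)\<^sup>2"
        using False e(2) \<open>0 \<le> B\<close> by (intro mult_left_mono power_mono) auto
      also have "\<dots> \<le> b * (norm x)\<^sup>2" by (intro mult_right_mono) (auto simp: b_def)
      finally show ?thesis using B[OF p] by linarith
    qed
  qed
qed

text \<open>The third property stands in for optimality: the final comparison leaves a plan no more
  expensive than the local one whenever that is feasible, whatever the solver did.\<close>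

lemma alg_returns_feasible:
  assumes "feasible S x c" "alg_returns S x c p"
  shows "feasible S x p" "plan_cost S p \<le> plan_cost S c"
    "feasible S x (local_plan S x) \<Longrightarrow> plan_cost S p \<le> plan_cost S (local_plan S x)"
  using assms unfolding alg_returns_def by (auto split: if_splits)

theorem exponentially_stable: "exponentially_stable_on (feasible_states S) (closed_loop S)"
proof -
  obtain a where a: "0 < a"
    "\<And>x p. feasible S x p \<Longrightarrow> a * (norm x)\<^sup>2 \<le> stage_cost S (xbar p 0) (ubar p 0) (delta p 0)"
    using norm_le_stage_cost by blast
  obtain b0 where b0: "0 < b0"
    "\<And>x p. feasible S x p \<Longrightarrow> (feasible S x (local_plan S x) \<Longrightarrow> plan_cost S p \<le> plan_cost S (local_plan S x))
      \<Longrightarrow> plan_cost S p \<le> b0 * (norm x)\<^sup>2"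
    using cost_le_norm by blast
  \<comment> \<open>The maximum with \<open>2 * a\<close> keeps \<tau> = 1 - a / b strictly
    positive, as the decay rate must be.\<close>
  define b where "b = max b0 (2 * a)"
  have b: "0 < b" "2 * a \<le> b" using a(1) by (auto simp: b_def)
  have b0b: "b0 * (norm x)\<^sup>2 \<le> b * (norm x)\<^sup>2" for x :: "(real, 'nx) vec"
    by (intro mult_right_mono) (auto simp: b_def)
  define \<tau> where "\<tau> = 1 - a / b"
  have \<tau>: "0 < \<tau>" "\<tau> < 1" using a(1) b by (auto simp: \<tau>_def field_simps)
  have "norm (x k) \<le> sqrt (b / a) * sqrt \<tau> ^ k * norm (x 0)" if "closed_loop S x" for x k
  proof -
    obtain c p where c0: "feasible S (x 0) (c 0)"
      and cS: "\<And>k. c (Suc k) = shifted_plan S (x (Suc k)) (p k)"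
      and ret: "\<And>k. alg_returns S (x k) (c k) (p k)"
      and xS: "\<And>k. x (Suc k) = Fmap S (x k) (kappa S (x k) (xbar (p k) 0) (ubar (p k) 0))"
      using \<open>closed_loop S x\<close> unfolding closed_loop_def by blast
    have fc: "feasible S (x k) (c k)" for k
    proof (induction k)
      case (Suc k)
      then show ?case
        using shifted_plan_feasible(1)[OF alg_returns_feasible(1)[OF Suc ret] xS] by (simp add: cS)
    qed (rule c0)
    note fp = alg_returns_feasible(1)[OF fc ret]
    have up: "plan_cost S (p k) \<le> b * (norm (x k))\<^sup>2" for k
      using b0(2)[OF fp alg_returns_feasible(3)[OF fc ret]] b0b order_trans by blast
    have lo: "a * (norm (x k))\<^sup>2 \<le> plan_cost S (p k)" for k
    proof -
      have "stage_cost S (xbar (p k) 0) (ubar (p k) 0) (delta (p k) 0) \<le> plan_cost S (p k)"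
        unfolding plan_cost_eq using weights(3,4) rho
          member_le_sum[of 0 "{..<N}" "\<lambda>i. stage_cost S (xbar (p k) i) (ubar (p k) i) (delta (p k) i)"]
          stage_cost_nonneg by (simp add: add_increasing2)
      then show ?thesis using a(2)[OF fp[of k]] by linarith
    qed
    have dec: "plan_cost S (p (Suc k)) \<le> \<tau> * plan_cost S (p k)" for k
    proof -
      have "plan_cost S (p (Suc k)) \<le> plan_cost S (p k) - a * (norm (x k))\<^sup>2"
        using alg_returns_feasible(2)[OF fc ret, of "Suc k"] shifted_plan_feasible(2)[OF fp xS, of k] a(2)[OF fp[of k]]
        by (simp add: cS)
      \<comment> \<open>The quadratic upper bound turns the decrease by the stage cost into a
        decrease by a fixed fraction of the cost.\<close>
      moreover have "a / b * plan_cost S (p k) \<le> a * (norm (x k))\<^sup>2"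
        using mult_left_mono[OF up[of k], of "a / b"] a(1) b(1) by simp
      ultimately show ?thesis by (simp add: \<tau>_def algebra_simps)
    qed
    have "plan_cost S (p k) \<le> \<tau> ^ k * plan_cost S (p 0)" for k
    proof (induction k)
      case (Suc k)
      have "\<tau> * plan_cost S (p k) \<le> \<tau> * (\<tau> ^ k * plan_cost S (p 0))"
        using Suc \<tau>(1) by simp
      then show ?case using dec[of k] by (simp add: mult.assoc)
    qed simp
    then have "a * (norm (x k))\<^sup>2 \<le> \<tau> ^ k * (b * (norm (x 0))\<^sup>2)"
      using lo[of k] mult_left_mono[OF up[of 0], of "\<tau> ^ k"] \<tau>(1) by (meson order_trans zero_le_power less_imp_le)
    then have "(norm (x k))\<^sup>2 \<le> b / a * \<tau> ^ k * (norm (x 0))\<^sup>2"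
      using a(1) by (simp add: field_simps)
    then have "sqrt ((norm (x k))\<^sup>2) \<le> sqrt (b / a * \<tau> ^ k * (norm (x 0))\<^sup>2)"
      by (rule real_sqrt_le_mono)
    then show ?thesis
      by (simp only: real_sqrt_mult real_sqrt_abs abs_norm_cancel) (simp only: real_sqrt_power)
  qed
  then show ?thesis
    unfolding exponentially_stable_on_def
    using a(1) b(1) \<tau> by (intro exI[of _ "sqrt (b / a)"] exI[of _ "sqrt \<tau>"]) auto
qed

end

theorem theorem3:
  fixes S :: "('nx::{finite,linorder}, 'ne::finite, 'nu::finite, 'd::finite, 'j::finite) setting"
  assumes "system_assms S"
    and "learned_assms S"
    and "geodesic_selection S"
    and "mpc_assms S"
    and "untightened_regular S"
    and "rccm S"
    and "peb S"
    and "term_ctrl S = (\<lambda>xb. 0)"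
    and "term_cost S = (\<lambda>xb \<delta>. weightD S / rho_c S * \<delta>\<^sup>2)"
    and "term_set S = {(xb, \<delta>). 0 \<le> \<delta> \<and> xb = 0 \<and>
           (\<forall>j. hcon S j xb (term_ctrl S xb) + tightening S j * \<delta> \<le> 0)}"
  shows "exponentially_stable_on (feasible_states S) (closed_loop S)"
  by (rule tube_mpc.exponentially_stable, unfold_locales) (fact assms)+

end
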